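(* There exists a universal constant $C>0$ such that the following holds. Let $n$ be a positive integer, let $\theta^*\in\mathcal{U}_n$ be a unimodal sequence, let $\sigma>0$, and let $y=\theta^*+z$ where $z\sim N(0,\sigma^2 I_n)$. Let $V(\theta^* )=\max_{1\le i\le n}\theta^*_i-\min_{1\le i\le n}\theta^*_i$, and let $\hat\theta\in\arg\min_{\theta\in\mathcal{U}_n}\|y-\theta\|^2$ be a least squares estimator. Then for every $\alpha>0$, with probability at least $1-2n^{-\alpha}$, $$\frac1n\|\hat\theta-\theta^*\|^2\le C\,\sigma^{4/3}\bigl(V(\theta^* )+\sigma\bigr)^{2/3}n^{-2/3}+(C+24\alpha)\,\sigma^2\,\frac{\log n}{n}.$$
   Context: $\|\cdot\|$ is the Euclidean norm on $\mathbb{R}^n$. For $1\le m\le n$ let $C_m=\{\theta\in\mathbb{R}^n:\theta_1\le\theta_2\le\dots\le\theta_m\ge\theta_{m+1}\ge\dots\ge\theta_n\}$, and let $\mathcal{U}_n=\bigcup_{m=1}^n C_m$ be the set of unimodal sequences of length $n$. Since $\mathcal{U}_n$ is closed but not convex, the least squares estimator may be non-unique; $\hat\theta$ denotes an arbitrary choice among the minimizers. *)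

theory Defs
  imports "HOL-Probability.Probability"
begin

text \<open>
  The dimension \<open>n\<close> is quantified after the universal constant, so it cannot be a type. A vector in
  \<open>\<real>\<^sup>n\<close> is represented by a function \<open>nat \<Rightarrow> real\<close> of which only the values at the indices \<open>1, \<dots>, n\<close>
  are ever used.
\<close>

definition unimodal_cone :: "nat \<Rightarrow> nat \<Rightarrow> (nat \<Rightarrow> real) set" where
  "unimodal_cone n m =
    {\<theta>. (\<forall>i\<in>{1..<m}. \<theta> i \<le> \<theta> (i + 1)) \<and> (\<forall>i\<in>{m..<n}. \<theta> i \<ge> \<theta> (i + 1))}"

definition unimodal_seqs :: "nat \<Rightarrow> (nat \<Rightarrow> real) set" where
  "unimodal_seqs n = (\<Union>m\<in>{1..n}. unimodal_cone n m)"

definition eucl_norm :: "nat \<Rightarrow> (nat \<Rightarrow> real) \<Rightarrow> real" where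
  "eucl_norm n v = L2_set v {1..n}"

definition is_LSE :: "nat \<Rightarrow> (nat \<Rightarrow> real) \<Rightarrow> (nat \<Rightarrow> real) \<Rightarrow> bool" where
  "is_LSE n y \<theta> \<longleftrightarrow>
    is_arg_min (\<lambda>\<phi>. (eucl_norm n (\<lambda>i. y i - \<phi> i))\<^sup>2) (\<lambda>\<phi>. \<phi> \<in> unimodal_seqs n) \<theta>"

definition total_range :: "nat \<Rightarrow> (nat \<Rightarrow> real) \<Rightarrow> real" where
  "total_range n \<theta> = Max (\<theta> ` {1..n}) - Min (\<theta> ` {1..n})"

text \<open>
  The law \<open>N(0, \<sigma>\<^sup>2 I\<^sub>n)\<close>: independent coordinates, each normal with mean \<open>0\<close> and standard
  deviation \<open>\<sigma>\<close> (the second parameter of \<^const>\<open>normal_density\<close> is not the variance).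
\<close>

definition gaussian_noise :: "nat \<Rightarrow> real \<Rightarrow> (nat \<Rightarrow> real) measure" where
  "gaussian_noise n \<sigma> = (\<Pi>\<^sub>M i\<in>{1..n}. density lborel (\<lambda>x. ennreal (normal_density 0 \<sigma> x)))"

text \<open>
  \<open>holds_with_prob_at_least M p P\<close>: outside an event of probability at most \<open>1 - p\<close>, \<open>P\<close> holds.
  The set where \<open>P\<close> holds need not itself be an event, since \<open>P\<close> will refer to an
  arbitrary, possibly non-measurable, choice of minimizers. For measurable \<open>P\<close> and a
  probability measure this says that \<open>P\<close> has probability at least \<open>p\<close>.
\<close>

definition holds_with_prob_at_least :: "'a measure \<Rightarrow> real \<Rightarrow> ('a \<Rightarrow> bool) \<Rightarrow> bool" where
  "holds_with_prob_at_least M p P \<longleftrightarrow> (\<exists>A\<in>sets M. measure M A \<ge> p \<and> (\<forall>\<omega>\<in>A. P \<omega>))"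

lemma prob_space_gaussian_noise: "\<sigma> > 0 \<Longrightarrow> prob_space (gaussian_noise n \<sigma>)"
  unfolding gaussian_noise_def by (intro prob_space_PiM prob_space_normal_density)

lemma (in prob_space) holds_with_prob_at_least_iff:
  assumes "{\<omega> \<in> space M. P \<omega>} \<in> events"
  shows "holds_with_prob_at_least M p P \<longleftrightarrow> prob {\<omega> \<in> space M. P \<omega>} \<ge> p"
proof
  assume "holds_with_prob_at_least M p P"
  then obtain A where A: "A \<in> events" "prob A \<ge> p" "\<forall>\<omega>\<in>A. P \<omega>"
    unfolding holds_with_prob_at_least_def by blast
  with sets.sets_into_space have "A \<subseteq> {\<omega> \<in> space M. P \<omega>}" by blast
  then have "prob A \<le> prob {\<omega> \<in> space M. P \<omega>}" by (rule finite_measure_mono[OF _ assms])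
  with A show "prob {\<omega> \<in> space M. P \<omega>} \<ge> p" by linarith
next
  assume "prob {\<omega> \<in> space M. P \<omega>} \<ge> p"
  with assms show "holds_with_prob_at_least M p P"
    unfolding holds_with_prob_at_least_def by blast
qed

end

theory Submission
  imports Defs
begin

text \<open>
  Clip the estimator to the range of \<open>\<theta>\<close> enlarged by \<open>14 \<sigma>\<close>, so that the error splits as \<open>d = g + e\<close>
  with \<open>g\<close> of variation \<open>O(V + \<sigma>)\<close> and \<open>e\<close> the clipped excess. The basic inequality
  \<open>\<parallel>d\<parallel>\<^sup>2 \<le> 2 \<langle>z, g\<rangle> + 2 \<langle>z, e\<rangle>\<close> is bounded term by term.

  In a Haar basis the noise coefficients are again independent and normal, while the level-wise
  \<open>\<ell>\<^sup>1\<close> norms of the coefficients of \<open>g\<close> are controlled by its variation. Splitting every noise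
  coefficient at a threshold that grows slowly with the resolution replaces chaining: the part below
  the threshold is paired with the \<open>\<ell>\<^sup>1\<close> norms, and the excess has a squared \<open>\<ell>\<^sup>2\<close> norm with
  bounded exponential moments, which is paired with \<open>\<parallel>g\<parallel>\<close>.

  The superlevel sets of \<open>\<bar>e\<bar>\<close> range over polynomially many sets. On each of them either the signed
  noise sum is small compared with \<open>\<sigma>\<close> times the cardinality, which is absorbed by
  \<open>2 \<langle>g, e\<rangle> \<ge> 28 \<sigma> \<parallel>e\<parallel>\<^sub>1\<close>, or the noise has norm \<open>O(\<sigma> sqrt (log n))\<close>.
\<close>

section \<open>Gaussian integrals\<close>

abbreviation centered_normal :: "real \<Rightarrow> real measure" where
  "centered_normal \<sigma> \<equiv> density lborel (\<lambda>x. ennreal (normal_density 0 \<sigma> x))"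

lemma product_sigma_finite_centered_normal:
  assumes "\<sigma> > 0"
  shows "product_sigma_finite (\<lambda>_. centered_normal \<sigma>)"
  by (simp add: product_sigma_finite_def assms prob_space_imp_sigma_finite
      prob_space_normal_density)

text \<open>The weight changes the exponent factor -1/2 into -1/2 + 3/8 = -1/8, that of standard
  deviation \<open>2 * \<sigma>\<close>; the ratio of the two normalizing factors is the value
  2.\<close>

lemma nn_integral_exp_square_normal:
  fixes \<sigma> :: real
  assumes "\<sigma> > 0"
  shows "(\<integral>\<^sup>+x. ennreal (exp (3/8 * (x/\<sigma>)\<^sup>2)) \<partial>centered_normal \<sigma>) = 2"
proof -
  have eq: "normal_density 0 \<sigma> x * exp (3/8 * (x/\<sigma>)\<^sup>2) = 2 * normal_density 0 (2*\<sigma>) x" for x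
  proof -
    have "sqrt (2 * pi * (2*\<sigma>)\<^sup>2) = 2 * sqrt (2 * pi * \<sigma>\<^sup>2)"
      using real_sqrt_mult[of 4 "2 * pi * \<sigma>\<^sup>2"] by (simp add: power_mult_distrib)
    moreover have "exp (- x\<^sup>2 / (2 * \<sigma>\<^sup>2)) * exp (3/8 * (x/\<sigma>)\<^sup>2) = exp (- x\<^sup>2 / (2 * (2*\<sigma>)\<^sup>2))"
      unfolding exp_add[symmetric]
      using assms by (intro arg_cong[of _ _ exp]) (simp add: field_simps power2_eq_square)
    ultimately show ?thesis
      using assms by (simp add: normal_density_def field_simps)
  qed
  have "(\<integral>\<^sup>+x. ennreal (exp (3/8 * (x/\<sigma>)\<^sup>2)) \<partial>centered_normal \<sigma>)
     = (\<integral>\<^sup>+x. ennreal (2 * normal_density 0 (2*\<sigma>) x) \<partial>lborel)"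
    by (subst nn_integral_density) (auto simp: eq[symmetric] ennreal_mult)
  also have "\<dots> = 2 * (\<integral>\<^sup>+x. ennreal (normal_density 0 (2*\<sigma>) x) \<partial>lborel)"
    by (subst nn_integral_cmult[symmetric]) (auto simp: ennreal_mult)
  also have "(\<integral>\<^sup>+x. ennreal (normal_density 0 (2*\<sigma>) x) \<partial>lborel) = 1"
  proof -
    interpret prob_space "centered_normal (2*\<sigma>)"
      using assms by (intro prob_space_normal_density) simp
    show ?thesis
      using emeasure_space_1 by (simp add: emeasure_density)
  qed
  finally show ?thesis by simp
qed

text \<open>The linear map is orthogonal, so it preserves the joint density. The variables are
  changed one at a time: at fixed \<open>x\<close>, \<open>y\<close> is replaced by u = a x + b y;
  after exchanging the integrals, x = a u + b v introduces \<open>v\<close>. The Jacobian factors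
  1/b and b cancel.\<close>

lemma nn_integral_normal_rotation:
  fixes a b \<sigma> :: real and G :: "real \<times> real \<Rightarrow> ennreal"
  assumes \<sigma>: "\<sigma> > 0" and ab: "a\<^sup>2 + b\<^sup>2 = 1" and b: "b > 0"
    and G[measurable]: "G \<in> borel_measurable (borel \<Otimes>\<^sub>M borel)"
  shows "(\<integral>\<^sup>+x. \<integral>\<^sup>+y. G (a * x + b * y, b * x - a * y) \<partial>centered_normal \<sigma> \<partial>centered_normal \<sigma>)
       = (\<integral>\<^sup>+x. \<integral>\<^sup>+y. G (x, y) \<partial>centered_normal \<sigma> \<partial>centered_normal \<sigma>)"
proof -
  let ?\<phi> = "\<lambda>x. ennreal (normal_density 0 \<sigma> x)"
  have aa: "a * a = 1 - b * b" using ab by (simp add: power2_eq_square)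
  have "(\<integral>\<^sup>+x. \<integral>\<^sup>+y. G (a * x + b * y, b * x - a * y) \<partial>centered_normal \<sigma> \<partial>centered_normal \<sigma>)
      = (\<integral>\<^sup>+x. \<integral>\<^sup>+y. ?\<phi> x * (?\<phi> y * G (a * x + b * y, b * x - a * y)) \<partial>lborel \<partial>lborel)"
    by (simp add: nn_integral_density nn_integral_cmult)
  also have "\<dots> = (\<integral>\<^sup>+x. \<integral>\<^sup>+u. ennreal (1/b) * (?\<phi> x * (?\<phi> ((u-a * x)/b) * G (u, (x-a * u)/b)))
                     \<partial>lborel \<partial>lborel)"
  proof (rule nn_integral_cong)
    fix x
    have "a * x + b * (1/b * u - a * x/b) = u" for u
      using b by (simp add: field_simps)
    moreover have "b * x - a * (1/b * u - a * x/b) = (x - a * u)/b" for u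
    proof -
      have "b * (b * x - a * (1/b * u - a * x/b)) = b*b * x - a * u + a*a * x"
        using b by (simp add: field_simps)
      also have "\<dots> = x - a * u" by (simp add: aa algebra_simps)
      finally show ?thesis using b by (metis less_irrefl nonzero_mult_div_cancel_left)
    qed
    moreover have "- (a * x/b) + 1/b * u = (u - a * x)/b" for u
      by (simp add: diff_divide_distrib)
    ultimately show "(\<integral>\<^sup>+y. ?\<phi> x * (?\<phi> y * G (a * x + b * y, b * x - a * y)) \<partial>lborel)
      = (\<integral>\<^sup>+u. ennreal (1/b) * (?\<phi> x * (?\<phi> ((u-a * x)/b) * G (u, (x-a * u)/b))) \<partial>lborel)"
      using b
      by (subst nn_integral_real_affine[where c = "1/b" and t = "- (a * x/b)"])
        (auto simp: nn_integral_cmult[symmetric] algebra_simps diff_divide_distrib)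
  qed
  also have "\<dots> = (\<integral>\<^sup>+u. \<integral>\<^sup>+x. ennreal (1/b) * (?\<phi> x * (?\<phi> ((u-a * x)/b) * G (u, (x-a * u)/b)))
                     \<partial>lborel \<partial>lborel)"
    by (intro lborel_pair.Fubini') simp
  also have "\<dots> = (\<integral>\<^sup>+u. \<integral>\<^sup>+v. ?\<phi> u * (?\<phi> v * G (u, v)) \<partial>lborel \<partial>lborel)"
  proof (rule nn_integral_cong)
    fix u
    have sq: "(u - a * (a * u + b * v)) / b = b * u - a * v" for v
    proof -
      have "u - a * (a * u + b * v) = u - (a*a)*u - a*b * v" by (simp add: algebra_simps)
      also have "\<dots> = b * (b * u - a * v)" by (simp add: aa algebra_simps)
      finally show ?thesis using b by simp
    qed
    have \<phi>\<phi>: "?\<phi> (a * u + b * v) * ?\<phi> (b * u - a * v) = ?\<phi> u * ?\<phi> v" for v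
    proof -
      have "(a * u + b * v)\<^sup>2 + (b * u - a * v)\<^sup>2 = (a\<^sup>2 + b\<^sup>2) * u\<^sup>2 + (a\<^sup>2 + b\<^sup>2) * v\<^sup>2"
        by algebra
      then have "(a * u + b * v)\<^sup>2 + (b * u - a * v)\<^sup>2 = u\<^sup>2 + v\<^sup>2" by (simp add: ab)
      then have "exp (- (a * u + b * v)\<^sup>2 / (2*\<sigma>\<^sup>2)) * exp (- (b * u - a * v)\<^sup>2 / (2*\<sigma>\<^sup>2))
          = exp (- u\<^sup>2 / (2*\<sigma>\<^sup>2)) * exp (- v\<^sup>2 / (2*\<sigma>\<^sup>2))"
        unfolding exp_add[symmetric] add_divide_distrib[symmetric] by (simp add: algebra_simps)
      then have "normal_density 0 \<sigma> (a * u + b * v) * normal_density 0 \<sigma> (b * u - a * v)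
          = normal_density 0 \<sigma> u * normal_density 0 \<sigma> v"
        by (simp add: normal_density_def)
      then show ?thesis by (simp add: ennreal_mult[symmetric])
    qed
    have bb: "ennreal b * ennreal (1/b) = 1"
      using b by (simp add: ennreal_mult[symmetric])
    have "(\<integral>\<^sup>+x. ennreal (1/b) * (?\<phi> x * (?\<phi> ((u-a * x)/b) * G (u, (x-a * u)/b))) \<partial>lborel)
       = (\<integral>\<^sup>+v. ennreal b * (ennreal (1/b) * (?\<phi> (a * u + b * v) * (?\<phi> (b * u - a * v) * G (u, v)))) \<partial>lborel)"
      using b
      by (subst nn_integral_real_affine[where c = b and t = "a * u"])
        (auto simp: nn_integral_cmult[symmetric] sq)
    also have "\<dots> = (\<integral>\<^sup>+v. ?\<phi> u * (?\<phi> v * G (u, v)) \<partial>lborel)"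
      by (intro nn_integral_cong) (simp add: mult.assoc[symmetric] bb \<phi>\<phi>)
    finally show "(\<integral>\<^sup>+x. ennreal (1/b) * (?\<phi> x * (?\<phi> ((u-a * x)/b) * G (u, (x-a * u)/b))) \<partial>lborel)
       = (\<integral>\<^sup>+v. ?\<phi> u * (?\<phi> v * G (u, v)) \<partial>lborel)" .
  qed
  also have "\<dots> = (\<integral>\<^sup>+x. \<integral>\<^sup>+y. G (x, y) \<partial>centered_normal \<sigma> \<partial>centered_normal \<sigma>)"
    by (simp add: nn_integral_density nn_integral_cmult)
  finally show ?thesis .
qed

section \<open>Plane rotations of product normal noise\<close>

text \<open>For \<open>i \<noteq> j\<close> and a^2 + b^2 = 1 this is orthogonal, strictly speaking
  a reflection: it is its own inverse.\<close>

definition rotation :: "real \<Rightarrow> real \<Rightarrow> nat \<Rightarrow> nat \<Rightarrow> (nat \<Rightarrow> real) \<Rightarrow> nat \<Rightarrow> real" where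
  "rotation a b i j x = x(i := a * x i + b * x j, j := b * x i - a * x j)"

lemma measurable_rotation:
  assumes "i \<in> I" "j \<in> I"
  shows "rotation a b i j \<in> measurable (\<Pi>\<^sub>M i\<in>I. centered_normal \<sigma>) (\<Pi>\<^sub>M i\<in>I. centered_normal \<sigma>)"
proof (rule measurable_PiM_single')
  fix k assume [simp]: "k \<in> I"
  have [measurable]: "(\<lambda>x. x m) \<in> borel_measurable (\<Pi>\<^sub>M i\<in>I. centered_normal \<sigma>)" if "m \<in> I" for m
    using measurable_component_singleton[OF that, of "\<lambda>_. centered_normal \<sigma>"]
    by (simp add: measurable_def)
  show "(\<lambda>x. rotation a b i j x k) \<in> measurable (\<Pi>\<^sub>M i\<in>I. centered_normal \<sigma>) (centered_normal \<sigma>)"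
    using assms by (cases "k = j"; cases "k = i") (simp_all add: rotation_def)
next
  show "rotation a b i j \<in> space (\<Pi>\<^sub>M i\<in>I. centered_normal \<sigma>) \<rightarrow> (\<Pi>\<^sub>E i\<in>I. space (centered_normal \<sigma>))"
    using assms by (auto simp: rotation_def space_PiM PiE_def extensional_def)
qed

text \<open>The two moved coordinates are integrated innermost, so the planar case applies to each
  slice on which the others are fixed.\<close>

lemma nn_integral_rotation:
  assumes \<sigma>: "\<sigma> > 0" and ab: "a\<^sup>2 + b\<^sup>2 = 1" and b: "b > 0"
    and ij: "i \<in> I" "j \<in> I" "i \<noteq> j" and I: "finite I"
    and F[measurable]: "F \<in> borel_measurable (\<Pi>\<^sub>M i\<in>I. centered_normal \<sigma>)"
  shows "(\<integral>\<^sup>+x. F (rotation a b i j x) \<partial>(\<Pi>\<^sub>M i\<in>I. centered_normal \<sigma>))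
       = (\<integral>\<^sup>+x. F x \<partial>(\<Pi>\<^sub>M i\<in>I. centered_normal \<sigma>))"
proof -
  interpret product_sigma_finite "\<lambda>_::nat. centered_normal \<sigma>"
    by (rule product_sigma_finite_centered_normal[OF \<sigma>])
  define J where "J = I - {i, j}"
  have IJ: "I = insert j (insert i J)" and J: "finite J" "i \<notin> J" "j \<notin> insert i J"
    using ij I by (auto simp: J_def)
  let ?P = "\<lambda>K. \<Pi>\<^sub>M i\<in>K. centered_normal \<sigma>"
  have iter: "(\<integral>\<^sup>+x. H x \<partial>?P I)
      = (\<integral>\<^sup>+x. \<integral>\<^sup>+s. \<integral>\<^sup>+t. H (x(i := s, j := t)) \<partial>centered_normal \<sigma> \<partial>centered_normal \<sigma> \<partial>?P J)"
    if H[measurable]: "H \<in> borel_measurable (?P I)" for H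
  proof -
    have H': "H \<in> borel_measurable (?P (insert j (insert i J)))"
      using H by (simp add: IJ)
    have [measurable]: "(\<lambda>(x, t). x(j := t)) \<in> measurable (?P (insert i J) \<Otimes>\<^sub>M centered_normal \<sigma>) (?P I)"
      unfolding IJ by (rule measurable_add_dim)
    have "(\<lambda>(x, t). H (x(j := t))) \<in> borel_measurable (?P (insert i J) \<Otimes>\<^sub>M centered_normal \<sigma>)"
      by measurable
    then have "(\<lambda>x. \<integral>\<^sup>+t. H (x(j := t)) \<partial>centered_normal \<sigma>) \<in> borel_measurable (?P (insert i J))"
      by (intro sigma_finite_measure.borel_measurable_nn_integral sigma_finite_measures)
    then show ?thesis
      unfolding IJ using J H' by (simp add: product_nn_integral_insert)
  qed
  have slice: "(\<lambda>(s, t). F (x(i := s, j := t))) \<in> borel_measurable (borel \<Otimes>\<^sub>M borel)"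
    if x: "x \<in> space (?P J)" for x
  proof -
    have "(\<lambda>p. x(i := fst p, j := snd p)) \<in> measurable (borel \<Otimes>\<^sub>M borel) (?P I)"
    proof (rule measurable_PiM_single')
      fix k assume "k \<in> I"
      show "(\<lambda>p. (x(i := fst p, j := snd p)) k) \<in> measurable (borel \<Otimes>\<^sub>M borel) (centered_normal \<sigma>)"
        by (cases "k = j"; cases "k = i") simp_all
    next
      show "(\<lambda>p. x(i := fst p, j := snd p)) \<in> space (borel \<Otimes>\<^sub>M borel) \<rightarrow> (\<Pi>\<^sub>E i\<in>I. space (centered_normal \<sigma>))"
        using x by (auto simp: IJ space_PiM PiE_def extensional_def)
    qed
    then have "(\<lambda>p. F (x(i := fst p, j := snd p))) \<in> borel_measurable (borel \<Otimes>\<^sub>M borel)"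
      by measurable
    then show ?thesis by (simp add: case_prod_beta')
  qed
  have "(\<integral>\<^sup>+x. F (rotation a b i j x) \<partial>?P I)
      = (\<integral>\<^sup>+x. \<integral>\<^sup>+s. \<integral>\<^sup>+t. F (rotation a b i j (x(i := s, j := t))) \<partial>centered_normal \<sigma> \<partial>centered_normal \<sigma> \<partial>?P J)"
    using measurable_compose[OF measurable_rotation[OF ij(1,2)] F] by (rule iter)
  also have "\<dots> = (\<integral>\<^sup>+x. \<integral>\<^sup>+s. \<integral>\<^sup>+t. (\<lambda>(s, t). F (x(i := s, j := t))) (a * s + b * t, b * s - a * t)
      \<partial>centered_normal \<sigma> \<partial>centered_normal \<sigma> \<partial>?P J)"
  proof (intro nn_integral_cong)
    fix x s t
    have "rotation a b i j (x(i := s, j := t)) = x(i := a * s + b * t, j := b * s - a * t)"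
      using ij by (auto simp: rotation_def fun_eq_iff)
    then show "F (rotation a b i j (x(i := s, j := t)))
        = (\<lambda>(s, t). F (x(i := s, j := t))) (a * s + b * t, b * s - a * t)"
      by simp
  qed
  also have "\<dots> = (\<integral>\<^sup>+x. \<integral>\<^sup>+s. \<integral>\<^sup>+t. (\<lambda>(s, t). F (x(i := s, j := t))) (s, t)
      \<partial>centered_normal \<sigma> \<partial>centered_normal \<sigma> \<partial>?P J)"
    using slice by (intro nn_integral_cong nn_integral_normal_rotation \<sigma> ab b)
  also have "\<dots> = (\<integral>\<^sup>+x. F x \<partial>?P I)"
    using iter[OF F] by simp
  finally show ?thesis .
qed

section \<open>The Haar transform\<close>

text \<open>
  The transform is computed in place: after processing the block \<open>{l..<l+N}\<close> the entry \<open>l\<close> holds the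
  normalized block sum and every other entry \<open>i\<close> holds the Haar coefficient of the unique sub-block
  that is split at \<open>i\<close>. Halves of unequal length are allowed, so \<open>N\<close> need not be a power of two.
\<close>

fun haar :: "nat \<Rightarrow> nat \<Rightarrow> (nat \<Rightarrow> real) \<Rightarrow> nat \<Rightarrow> real" where
  "haar l N =
    (if N \<le> 1 then id
     else rotation (sqrt (real (N div 2) / real N)) (sqrt (real (N - N div 2) / real N)) l (l + N div 2)
        \<circ> haar l (N div 2) \<circ> haar (l + N div 2) (N - N div 2))"

text \<open>The length of the sub-block of \<open>{l..<l+N}\<close> that is split at \<open>i\<close>.\<close>

fun haar_length :: "nat \<Rightarrow> nat \<Rightarrow> nat \<Rightarrow> nat" where
  "haar_length l N i =
    (if N \<le> 1 then 0
     else if i = l + N div 2 then N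
     else if i < l + N div 2 then haar_length l (N div 2) i
     else haar_length (l + N div 2) (N - N div 2) i)"

declare haar.simps[simp del] haar_length.simps[simp del]

text \<open>The recursion scheme shared by \<open>haar\<close> and \<open>haar_length\<close>: for N
  >= 2 both halves are strictly shorter than the block.\<close>

lemma halving_induct [case_names base split]:
  fixes P :: "nat \<Rightarrow> nat \<Rightarrow> bool"
  assumes "\<And>l N. N \<le> 1 \<Longrightarrow> P l N"
    and "\<And>l N. \<not> N \<le> 1 \<Longrightarrow> P l (N div 2) \<Longrightarrow> P (l + N div 2) (N - N div 2) \<Longrightarrow> P l N"
  shows "P l N"
proof (induction N arbitrary: l rule: less_induct)
  case (less N)
  then show ?case
    using assms by (cases "N \<le> 1") auto
qed

text \<open>The ratio 2/3 is attained by the longer half at N = 3. It keeps the halves comparable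
  and makes block lengths shrink geometrically.\<close>

lemma haar_halves:
  fixes N :: nat
  assumes "\<not> N \<le> 1"
  defines "p \<equiv> N div 2" and "q \<equiv> N - N div 2"
  shows "p \<ge> 1" "q \<ge> 1" "p + q = N" "3 * p \<le> 2 * N" "3 * q \<le> 2 * N"
    "(sqrt (real p / real N))\<^sup>2 + (sqrt (real q / real N))\<^sup>2 = 1"
    "sqrt (real q / real N) > 0"
proof -
  show pq: "p \<ge> 1" "q \<ge> 1" "p + q = N" "3 * p \<le> 2 * N" "3 * q \<le> 2 * N"
    using assms(1) unfolding p_def q_def by arith+
  have "real p + real q = real N" using pq(3) by linarith
  then show "(sqrt (real p / real N))\<^sup>2 + (sqrt (real q / real N))\<^sup>2 = 1"
    using assms(1) by (simp add: add_divide_distrib[symmetric])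
  show "sqrt (real q / real N) > 0" using pq by simp
qed

lemma haar_outside: "i \<notin> {l..<l+N} \<Longrightarrow> haar l N x i = x i"
proof (induction l N arbitrary: x rule: halving_induct)
  case (base l N)
  then show ?case by (simp add: haar.simps)
next
  case (split l N)
  note False = split(1)
  note h = haar_halves[OF False]
  have "i \<notin> {l..<l + N div 2}" "i \<notin> {l + N div 2..<l + N div 2 + (N - N div 2)}"
    "i \<noteq> l" "i \<noteq> l + N div 2"
    using split(4) h(1-3) by auto
  then show ?case
    using split(2)[of "haar (l + N div 2) (N - N div 2) x"] split(3)[of x]
    by (simp add: haar.simps[of l N] False rotation_def)
qed

text \<open>The last rotation acts on the normalized sums S1 / sqrt p and S2 / sqrt q of the halves.
  Its weights make the first output a normalized sum again; the second is the inner product with a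
  step function of mean zero, hence controllable by variation.\<close>

lemma haar_sum:
  assumes "N \<ge> 1"
  shows "haar l N x l = (\<Sum>i\<in>{l..<l+N}. x i) / sqrt (real N)"
    and "N > 1 \<Longrightarrow> haar l N x (l + N div 2) =
      (real (N - N div 2) * (\<Sum>i\<in>{l..<l + N div 2}. x i)
        - real (N div 2) * (\<Sum>i\<in>{l + N div 2..<l+N}. x i))
      / sqrt (real (N div 2) * real (N - N div 2) * real N)"
proof -
  have "haar l N x l = (\<Sum>i\<in>{l..<l+N}. x i) / sqrt (real N) \<and>
    (N > 1 \<longrightarrow> haar l N x (l + N div 2) =
      (real (N - N div 2) * (\<Sum>i\<in>{l..<l + N div 2}. x i)
        - real (N div 2) * (\<Sum>i\<in>{l + N div 2..<l+N}. x i))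
      / sqrt (real (N div 2) * real (N - N div 2) * real N))"
    using assms
  proof (induction l N arbitrary: x rule: halving_induct)
    case (base l N)
    then have "N = 1" by simp
    then show ?case by (simp add: haar.simps)
  next
    case (split l N)
    note False = split(1)
    note h = haar_halves[OF False]
    define p q where "p = N div 2" and "q = N - N div 2"
    define y where "y = haar (l + p) q x"
    define w where "w = haar l p y"
    have pq: "p \<ge> 1" "q \<ge> 1" "p + q = N" using h by (auto simp: p_def q_def)
    have eqN: "l + p + q = l + N" using pq by simp
    have yl: "(\<Sum>i\<in>{l..<l+p}. y i) = (\<Sum>i\<in>{l..<l+p}. x i)"
      unfolding y_def by (intro sum.cong haar_outside) auto
    have wl: "w l = (\<Sum>i\<in>{l..<l+p}. x i) / sqrt (real p)"
      using split(2)[of y] pq yl unfolding w_def p_def[symmetric]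
      by simp
    have wr: "w (l + p) = (\<Sum>i\<in>{l+p..<l+N}. x i) / sqrt (real q)"
    proof -
      have "w (l + p) = y (l + p)" unfolding w_def by (intro haar_outside) auto
      then show ?thesis
        using split(3)[of x] pq eqN unfolding y_def by (simp add: p_def q_def)
    qed
    have hN: "haar l N x = rotation (sqrt (real p / real N)) (sqrt (real q / real N)) l (l + p) w"
      using False by (simp add: haar.simps[of l N] w_def y_def p_def q_def)
    have sumsplit: "(\<Sum>i\<in>{l..<l+N}. x i) = (\<Sum>i\<in>{l..<l+p}. x i) + (\<Sum>i\<in>{l+p..<l+N}. x i)"
      using pq by (intro sum.atLeastLessThan_concat[symmetric]) auto
    have sp: "sqrt (real p) * sqrt (real p) = real p" "sqrt (real q) * sqrt (real q) = real q" by simp_all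
    have pos: "sqrt (real p) > 0" "sqrt (real q) > 0" "sqrt (real N) > 0" using pq by auto
    have 1: "haar l N x l = (\<Sum>i\<in>{l..<l+N}. x i) / sqrt (real N)"
      unfolding hN rotation_def sumsplit using pq wl wr pos
      by (simp add: real_sqrt_divide add_divide_distrib)
    have 2: "haar l N x (l + p) =
      (real q * (\<Sum>i\<in>{l..<l+p}. x i) - real p * (\<Sum>i\<in>{l+p..<l+N}. x i))
       / sqrt (real p * real q * real N)"
    proof -
      define S1 S2 where "S1 = (\<Sum>i\<in>{l..<l+p}. x i)" and "S2 = (\<Sum>i\<in>{l+p..<l+N}. x i)"
      have "haar l N x (l + p)
          = sqrt (real q) / sqrt (real N) * (S1 / sqrt (real p)) - sqrt (real p) / sqrt (real N) * (S2 / sqrt (real q))"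
        unfolding hN rotation_def S1_def S2_def using pq wl wr by (simp add: real_sqrt_divide)
      also have "\<dots> = (sqrt (real q) * sqrt (real q) * S1 - sqrt (real p) * sqrt (real p) * S2)
          / (sqrt (real p) * sqrt (real q) * sqrt (real N))"
        using pos by (simp add: field_simps del: real_sqrt_mult_self)
      finally show ?thesis unfolding sp S1_def S2_def by (simp add: real_sqrt_mult)
    qed
    show ?case using 1 2 by (simp add: p_def q_def)
  qed
  then show "haar l N x l = (\<Sum>i\<in>{l..<l+N}. x i) / sqrt (real N)"
    and "N > 1 \<Longrightarrow> haar l N x (l + N div 2) =
      (real (N - N div 2) * (\<Sum>i\<in>{l..<l + N div 2}. x i)
        - real (N div 2) * (\<Sum>i\<in>{l + N div 2..<l+N}. x i))
      / sqrt (real (N div 2) * real (N - N div 2) * real N)"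
    by blast+
qed

lemma rotation_inner:
  assumes "a\<^sup>2 + b\<^sup>2 = 1" "finite A" "i \<in> A" "j \<in> A" "i \<noteq> j"
  shows "(\<Sum>k\<in>A. rotation a b i j x k * rotation a b i j y k) = (\<Sum>k\<in>A. x k * y k)"
proof -
  have sumsplit: "sum f A = f i + f j + sum f (A - {i, j})" for f :: "nat \<Rightarrow> real"
    using assms by (simp add: sum.remove[of A i] sum.remove[of "A - {i}" j] Diff_insert2[symmetric])
  have "(a * x i + b * x j) * (a * y i + b * y j) + (b * x i - a * x j) * (b * y i - a * y j)
      = (a\<^sup>2 + b\<^sup>2) * (x i * y i) + (a\<^sup>2 + b\<^sup>2) * (x j * y j)"
    by algebra
  moreover have "(\<Sum>k\<in>A - {i, j}. rotation a b i j x k * rotation a b i j y k)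
      = (\<Sum>k\<in>A - {i, j}. x k * y k)"
    by (intro sum.cong) (auto simp: rotation_def)
  ultimately show ?thesis
    using assms by (simp add: sumsplit[of "\<lambda>k. x k * y k"]
        sumsplit[of "\<lambda>k. rotation a b i j x k * rotation a b i j y k"]) (simp add: rotation_def)
qed

text \<open>Parseval's identity: the transform is a composition of rotations within the
  block.\<close>

lemma haar_inner:
  "(\<Sum>i\<in>{l..<l+N}. haar l N x i * haar l N y i) = (\<Sum>i\<in>{l..<l+N}. x i * y i)"
proof (induction l N arbitrary: x y rule: halving_induct)
  case (base l N)
  then show ?case by (simp add: haar.simps)
next
  case (split l N)
  note False = split(1)
  note h = haar_halves[OF False]
  define p q where "p = N div 2" and "q = N - N div 2"
  have pq: "p \<ge> 1" "q \<ge> 1" "p + q = N" using h by (auto simp: p_def q_def)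
  have eqN: "l + p + q = l + N" using pq by simp
  have sumsplit: "(\<Sum>i\<in>{l..<l+N}. f i) = (\<Sum>i\<in>{l..<l+p}. f i) + (\<Sum>i\<in>{l+p..<l+N}. f i)"
    for f :: "nat \<Rightarrow> real"
    using pq by (intro sum.atLeastLessThan_concat[symmetric]) auto
  define w where "w = (\<lambda>x. haar l p (haar (l + p) q x))"
  have "(\<Sum>i\<in>{l..<l+N}. haar l N x i * haar l N y i) = (\<Sum>i\<in>{l..<l+N}. w x i * w y i)"
    using rotation_inner[OF h(6), of "{l..<l+N}" l "l + p"] pq
    by (simp add: haar.simps[of l N] False w_def p_def q_def)
  also have "\<dots> = (\<Sum>i\<in>{l..<l+p}. w x i * w y i) + (\<Sum>i\<in>{l+p..<l+N}. w x i * w y i)"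
    by (rule sumsplit)
  also have "(\<Sum>i\<in>{l..<l+p}. w x i * w y i)
      = (\<Sum>i\<in>{l..<l+p}. haar (l+p) q x i * haar (l+p) q y i)"
    unfolding w_def using split(2) by (simp add: p_def)
  also have "\<dots> = (\<Sum>i\<in>{l..<l+p}. x i * y i)"
    by (intro sum.cong) (auto simp: haar_outside)
  also have "(\<Sum>i\<in>{l+p..<l+N}. w x i * w y i)
      = (\<Sum>i\<in>{l+p..<l+N}. haar (l+p) q x i * haar (l+p) q y i)"
    unfolding w_def by (intro sum.cong) (auto simp: haar_outside)
  also have "\<dots> = (\<Sum>i\<in>{l+p..<l+N}. x i * y i)"
    using split(3)[of x y] eqN by (simp add: p_def q_def)
  finally show ?case by (simp add: sumsplit)
qed

lemma measurable_haar:
  assumes "{l..<l+N} \<subseteq> I"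
  shows "haar l N \<in> measurable (\<Pi>\<^sub>M i\<in>I. centered_normal \<sigma>) (\<Pi>\<^sub>M i\<in>I. centered_normal \<sigma>)"
  using assms
proof (induction l N rule: halving_induct)
  case (base l N)
  then show ?case by (simp add: haar.simps)
next
  case (split l N)
  note False = split(1)
  note h = haar_halves[OF False]
  have "{l..<l + N div 2} \<subseteq> {l..<l+N}"
    "{l + N div 2..<l + N div 2 + (N - N div 2)} \<subseteq> {l..<l+N}" "{l, l + N div 2} \<subseteq> {l..<l+N}"
    using h(1-3) by auto
  then have sub: "{l..<l + N div 2} \<subseteq> I"
    "{l + N div 2..<l + N div 2 + (N - N div 2)} \<subseteq> I" "l \<in> I" "l + N div 2 \<in> I"
    using split(4) by auto
  show ?case
    unfolding haar.simps[of l N] if_not_P[OF False] comp_assoc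
    by (rule measurable_comp[OF measurable_comp[OF split(3)[OF sub(2)] split(2)[OF sub(1)]]
          measurable_rotation[OF sub(3,4)], unfolded comp_assoc])
qed

text \<open>The Haar coefficients of the noise have the joint law of the noise itself.
  \<open>F\<close> varies in the induction because the maps applied later are absorbed into
  it.\<close>

lemma nn_integral_haar:
  assumes "\<sigma> > 0" "finite I" "{l..<l+N} \<subseteq> I"
    "F \<in> borel_measurable (\<Pi>\<^sub>M i\<in>I. centered_normal \<sigma>)"
  shows "(\<integral>\<^sup>+x. F (haar l N x) \<partial>(\<Pi>\<^sub>M i\<in>I. centered_normal \<sigma>))
       = (\<integral>\<^sup>+x. F x \<partial>(\<Pi>\<^sub>M i\<in>I. centered_normal \<sigma>))"
  using assms(3,4)
proof (induction l N arbitrary: F rule: halving_induct)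
  case (base l N)
  then show ?case by (simp add: haar.simps)
next
  case (split l N)
  note False = split(1)
  note h = haar_halves[OF False]
  let ?R = "rotation (sqrt (real (N div 2) / real N)) (sqrt (real (N - N div 2) / real N)) l (l + N div 2)"
  have sub: "{l..<l + N div 2} \<subseteq> I" "{l + N div 2..<l + N div 2 + (N - N div 2)} \<subseteq> I"
    "l \<in> I" "l + N div 2 \<in> I"
    using h(1-3) subset_trans[OF _ split(4)] subsetD[OF split(4)] by auto
  note R = measurable_rotation[OF sub(3,4)]
  have m1: "(\<lambda>x. F (?R x)) \<in> borel_measurable (\<Pi>\<^sub>M i\<in>I. centered_normal \<sigma>)"
    by (rule measurable_compose[OF R split(5)])
  have m2: "(\<lambda>x. F (?R (haar l (N div 2) x))) \<in> borel_measurable (\<Pi>\<^sub>M i\<in>I. centered_normal \<sigma>)"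
    by (rule measurable_compose[OF measurable_haar[OF sub(1)] m1])
  show ?case
    using split(2)[OF sub(1) m1] split(3)[OF sub(2) m2] h(1)
      nn_integral_rotation[OF assms(1) h(6,7) sub(3,4) _ assms(2) split(5)]
    by (simp add: haar.simps[of l N] False)
qed

section \<open>Soft thresholding of Haar coefficients\<close>

text \<open>Only increments inside the block count, so the variations of disjoint blocks add up to
  at most that of their union.\<close>

definition block_variation :: "nat \<Rightarrow> nat \<Rightarrow> (nat \<Rightarrow> real) \<Rightarrow> real" where
  "block_variation l N x = (\<Sum>i\<in>{l..<l + N - 1}. \<bar>x (Suc i) - x i\<bar>)"

lemma block_variation_nonneg: "block_variation l N x \<ge> 0"
  unfolding block_variation_def by (intro sum_nonneg) simp

lemma abs_diff_le_block_variation: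
  assumes "i \<in> {l..<l+N}" "j \<in> {l..<l+N}"
  shows "\<bar>x i - x j\<bar> \<le> block_variation l N x"
proof -
  have *: "\<bar>x j - x i\<bar> \<le> block_variation l N x" if "i \<le> j" "i \<in> {l..<l+N}" "j \<in> {l..<l+N}" for i j
  proof -
    have "x j - x i = (\<Sum>k\<in>{i..<j}. x (Suc k) - x k)"
      using that by (simp add: sum_Suc_diff')
    also have "\<bar>\<dots>\<bar> \<le> (\<Sum>k\<in>{i..<j}. \<bar>x (Suc k) - x k\<bar>)" by (rule sum_abs)
    also have "\<dots> \<le> block_variation l N x"
      unfolding block_variation_def using that by (intro sum_mono2) auto
    finally show ?thesis .
  qed
  show ?thesis
    using *[of i j] *[of j i] assms by (cases "i \<le> j") (auto simp: abs_minus_commute)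
qed

text \<open>The numerator q S1 - p S2 is the sum of x i - x j over all pairs from the two halves,
  hence at most p q times the variation. The arithmetic-geometric mean inequality then bounds sqrt
  (p q) by N / 2.\<close>

lemma haar_coeff_le_variation:
  assumes "N > 1"
  shows "\<bar>haar l N x (l + N div 2)\<bar> \<le> sqrt (real N) / 2 * block_variation l N x"
proof -
  define p q where "p = N div 2" and "q = N - N div 2"
  have pq: "p \<ge> 1" "q \<ge> 1" "p + q = N"
    using haar_halves[of N] assms by (auto simp: p_def q_def)
  have pqN: "real N = real p + real q" using pq(3) by simp
  define V where "V = block_variation l N x"
  have V: "V \<ge> 0" by (simp add: V_def block_variation_nonneg)
  have "real q * (\<Sum>i\<in>{l..<l+p}. x i) - real p * (\<Sum>j\<in>{l+p..<l+N}. x j)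
      = (\<Sum>i\<in>{l..<l+p}. \<Sum>j\<in>{l+p..<l+N}. x i - x j)"
    using pq(3) by (simp add: sum_subtractf sum_distrib_left[symmetric] sum_distrib_right[symmetric])
  also have "\<bar>\<dots>\<bar> \<le> (\<Sum>i\<in>{l..<l+p}. \<Sum>j\<in>{l+p..<l+N}. V)"
    unfolding V_def using pq
    by (intro order_trans[OF sum_abs] sum_mono abs_diff_le_block_variation) auto
  also have "\<dots> = real p * real q * V"
    using pq by simp
  finally have num: "\<bar>real q * (\<Sum>i\<in>{l..<l+p}. x i) - real p * (\<Sum>j\<in>{l+p..<l+N}. x j)\<bar>
      \<le> real p * real q * V" .
  have s: "sqrt (real p * real q) \<le> real N / 2"
    unfolding pqN by (rule arith_geo_mean_sqrt) simp_all
  have "haar l N x (l + N div 2)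
      = (real q * (\<Sum>i\<in>{l..<l+p}. x i) - real p * (\<Sum>j\<in>{l+p..<l+N}. x j))
        / sqrt (real p * real q * real N)"
    using haar_sum(2)[of N l x] assms by (simp add: p_def q_def)
  then have "\<bar>haar l N x (l + N div 2)\<bar> \<le> real p * real q * V / sqrt (real p * real q * real N)"
    using num by (simp add: divide_right_mono)
  also have "\<dots> \<le> sqrt (real N) / 2 * V"
  proof -
    define a c where "a = sqrt (real p * real q)" and "c = sqrt (real N)"
    have ac: "a > 0" "c > 0" and a2: "real p * real q = a * a" and c2: "real N = c * c"
      using pq by (auto simp: a_def c_def)
    have "a \<le> c * c / 2" using s unfolding a_def[symmetric] c2 .
    have "sqrt (real p * real q * real N) = a * c"
      by (simp add: a_def c_def real_sqrt_mult)
    then have "real p * real q * V / sqrt (real p * real q * real N) = a * V / c"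
      unfolding a2 using ac by simp
    also have "\<dots> \<le> (c * c / 2) * V / c"
      using \<open>a \<le> c * c / 2\<close> V ac by (intro divide_right_mono mult_right_mono) auto
    also have "\<dots> = c / 2 * V" using ac by simp
    finally show ?thesis by (simp add: c_def)
  qed
  finally show ?thesis by (simp add: V_def)
qed

lemma haar_length_left: "haar_length l N l = 0"
proof (induction l N rule: halving_induct)
  case (base l N)
  then show ?case by (simp add: haar_length.simps)
next
  case (split l N)
  then show ?case using haar_halves(1)[of N] by (simp add: haar_length.simps[of l N])
qed

text \<open>The correction term concerns the entry \<open>l + p\<close>: as first entry of the right
  half it has length 0, but the whole block is split there, which gives it length
  \<open>N\<close>.\<close>

lemma sum_haar_length_split:
  fixes f :: "nat \<Rightarrow> nat \<Rightarrow> real"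
  assumes "\<not> N \<le> 1"
  defines "p \<equiv> N div 2" and "q \<equiv> N - N div 2"
  shows "(\<Sum>i\<in>{l..<l+N}. f (haar_length l N i) i)
    = (\<Sum>i\<in>{l..<l+p}. f (haar_length l p i) i)
      + (\<Sum>i\<in>{l+p..<l+p+q}. f (haar_length (l + p) q i) i) + (f N (l + p) - f 0 (l + p))"
proof -
  have pq: "p \<ge> 1" "q \<ge> 1" "p + q = N"
    using haar_halves[of N] assms(1) by (auto simp: p_def q_def)
  then have eqN: "l + p + q = l + N" by simp
  have "(\<Sum>i\<in>{l..<l+N}. f (haar_length l N i) i)
      = (\<Sum>i\<in>{l..<l+p}. f (haar_length l N i) i) + (\<Sum>i\<in>{l+p..<l+N}. f (haar_length l N i) i)"
    using pq by (intro sum.atLeastLessThan_concat[symmetric]) auto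
  also have "(\<Sum>i\<in>{l..<l+p}. f (haar_length l N i) i) = (\<Sum>i\<in>{l..<l+p}. f (haar_length l p i) i)"
    using assms(1) by (intro sum.cong) (auto simp: haar_length.simps[of l N] p_def)
  also have "(\<Sum>i\<in>{l+p..<l+N}. f (haar_length l N i) i)
      = f N (l + p) + (\<Sum>i\<in>{Suc (l+p)..<l+N}. f (haar_length l N i) i)"
    using pq assms(1) by (subst sum.atLeast_Suc_lessThan) (auto simp: haar_length.simps[of l N] p_def)
  also have "(\<Sum>i\<in>{Suc (l+p)..<l+N}. f (haar_length l N i) i)
      = (\<Sum>i\<in>{Suc (l+p)..<l+N}. f (haar_length (l+p) q i) i)"
    using assms(1) by (intro sum.cong) (auto simp: haar_length.simps[of l N] p_def q_def)
  also have "\<dots> = (\<Sum>i\<in>{l+p..<l+N}. f (haar_length (l+p) q i) i) - f 0 (l + p)"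
    using pq by (subst (2) sum.atLeast_Suc_lessThan) (auto simp: haar_length_left)
  finally show ?thesis by (simp add: eqN)
qed

section \<open>Thresholds and the two sums they control\<close>

text \<open>\<open>N0\<close> is the critical block length. The fourth root is a compromise: the
  threshold times sqrt N still decreases geometrically on short blocks, while the exponential of its
  negative square outweighs the growing number of such blocks.\<close>

definition threshold :: "real \<Rightarrow> nat \<Rightarrow> real" where
  "threshold N0 N = (if real N < N0 then 3 * sqrt (sqrt (N0 / real N)) else 0)"

text \<open>The first entry of a block, whose \<^const>\<open>haar_length\<close> is 0, is not thresholded
  because \<^term>\<open>N0 / 0 = 0\<close>.\<close>

lemma threshold_0: "N0 > 0 \<Longrightarrow> threshold N0 0 = 0"
  by (simp add: threshold_def)

lemma threshold_nonneg: "threshold N0 N \<ge> 0"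
  by (cases "N0 \<ge> 0") (auto simp: threshold_def)

text \<open>With y = sqrt (N0 / N), the exponent is -27/8 y, and exp (27/8 y) >= exp (3/2 y)^2 >=
  y^4 by the quadratic Taylor bound.\<close>

lemma exp_threshold_le:
  assumes "N \<ge> 1" "N0 > 0"
  shows "exp (- 3/8 * (threshold N0 N)\<^sup>2) \<le> min 1 ((real N / N0)\<^sup>2)"
proof (cases "real N < N0")
  case True
  define y where "y = sqrt (N0 / real N)"
  have y: "y > 0" and y2: "y\<^sup>2 = N0 / real N" using assms by (auto simp: y_def)
  have "y\<^sup>2 \<le> exp (3/2 * y)"
  proof -
    have "(3/2 * y)\<^sup>2 / 2 = 9/8 * y\<^sup>2" by (simp add: power2_eq_square)
    then show ?thesis
      using exp_lower_Taylor_quadratic[of "3/2 * y"] y zero_le_power2[of y] by linarith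
  qed
  then have "(y\<^sup>2)\<^sup>2 \<le> (exp (3/2 * y))\<^sup>2" by (intro power_mono) auto
  also have "\<dots> = exp (3 * y)" by (simp add: exp_double[symmetric])
  also have "\<dots> \<le> exp (27/8 * y)" using y by simp
  finally have "inverse (exp (27/8 * y)) \<le> inverse ((y\<^sup>2)\<^sup>2)"
    using y by (intro le_imp_inverse_le) auto
  moreover have "inverse ((y\<^sup>2)\<^sup>2) = (real N / N0)\<^sup>2"
    unfolding y2 by (simp add: power_divide)
  moreover have "(threshold N0 N)\<^sup>2 = 9 * y"
    using True y by (simp add: threshold_def power_mult_distrib y_def)
  moreover have "exp (- (27/8 * y)) \<le> 1" using y by simp
  ultimately show ?thesis by (simp add: exp_minus)
next
  case False
  then show ?thesis using assms by (simp add: threshold_def)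
qed

text \<open>The potential 36 t^2 / (1 + t) is quadratic for small and linear for large t. Its gain
  when two comparable blocks merge is computed exactly and is at least 36 x y / (1 + s)^2, enough to
  pay for the coefficient at the split.\<close>

lemma superadditive_potential:
  fixes x y :: real
  assumes "x > 0" "y > 0" "2 * x \<le> 4 * y" "2 * y \<le> 4 * x"
  shows "36 * x\<^sup>2 / (1 + x) + 36 * y\<^sup>2 / (1 + y) + 2 * min 1 ((x + y)\<^sup>2) \<le> 36 * (x + y)\<^sup>2 / (1 + (x + y))"
proof -
  define s where "s = x + y"
  have s: "s > 0" "x \<le> s" "y \<le> s" using assms by (auto simp: s_def)
  have id: "36 * t\<^sup>2 / (1 + t) = 36 * (t - 1) + 36 / (1 + t)" if "t > 0" for t :: real
    using that by (simp add: field_simps power2_eq_square)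
  have "36 * s\<^sup>2 / (1 + s) - 36 * x\<^sup>2 / (1 + x) - 36 * y\<^sup>2 / (1 + y)
      = 36 * (x * y * (2 + s)) / ((1 + s) * ((1 + x) * (1 + y)))"
  proof -
    have "1 + 1 / c - 1 / a - 1 / b = (a - 1) * (b - 1) * (a + b) / (c * (a * b))"
      if "a > 0" "b > 0" "c > 0" "c = a + b - 1" for a b c :: real
    proof -
      have "a * b * c + a * b - b * c - a * c = (a - 1) * (b - 1) * (a + b)"
        unfolding that(4) by algebra
      moreover have "1 + 1 / c - 1 / a - 1 / b = (a * b * c + a * b - b * c - a * c) / (c * (a * b))"
        using that(1-3) by (simp add: field_simps)
      ultimately show ?thesis by simp
    qed
    from this[of "1 + x" "1 + y" "1 + s"]
    have "1 + 1 / (1 + s) - 1 / (1 + x) - 1 / (1 + y) = x * y * (2 + s) / ((1 + s) * ((1 + x) * (1 + y)))"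
      using assms(1,2) s(1) by (simp add: s_def add.assoc add.left_commute)
    moreover have "36 * (s - 1) + 36 / (1 + s) - (36 * (x - 1) + 36 / (1 + x)) - (36 * (y - 1) + 36 / (1 + y))
        = 36 * (1 + 1 / (1 + s) - 1 / (1 + x) - 1 / (1 + y))"
      by (simp add: s_def)
    ultimately show ?thesis
      unfolding id[OF s(1)] id[OF assms(1)] id[OF assms(2)] by simp
  qed
  also have "\<dots> \<ge> 36 * (x * y * (1 + s)) / ((1 + s) * ((1 + s) * (1 + s)))"
    using s assms by (intro frac_le mult_mono) auto
  also have "36 * (x * y * (1 + s)) / ((1 + s) * ((1 + s) * (1 + s))) = 36 * (x * y) / (1 + s)\<^sup>2"
    using s by (simp add: power2_eq_square)
  finally have 1: "36 * (x * y) / (1 + s)\<^sup>2 \<le> 36 * s\<^sup>2 / (1 + s) - 36 * x\<^sup>2 / (1 + x) - 36 * y\<^sup>2 / (1 + y)" .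
  \<comment> \<open>Comparability enters here: expanding the product gives 9 x y >= 2 s^2.\<close>
  have "0 \<le> (2 * x - y) * (2 * y - x)" using assms by (intro mult_nonneg_nonneg) auto
  then have xy: "8 * s\<^sup>2 \<le> 36 * (x * y)"
    by (simp add: s_def algebra_simps power2_eq_square)
  have "2 * min 1 (s\<^sup>2) * (1 + s)\<^sup>2 \<le> 8 * s\<^sup>2"
  proof (cases "s \<le> 1")
    case True
    then have "(1 + s)\<^sup>2 \<le> 2\<^sup>2" using s by (intro power_mono) auto
    then have "2 * s\<^sup>2 * (1 + s)\<^sup>2 \<le> 2 * s\<^sup>2 * 4" by (intro mult_left_mono) auto
    moreover have "min 1 (s\<^sup>2) = s\<^sup>2" using True s by (simp add: power_le_one)
    ultimately show ?thesis by simp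
  next
    case False
    then have "(1 + s)\<^sup>2 \<le> (2 * s)\<^sup>2" using s by (intro power_mono) auto
    moreover have "min 1 (s\<^sup>2) = 1" using False s by (simp add: one_le_power)
    ultimately show ?thesis by (simp add: power_mult_distrib)
  qed
  then have "2 * min 1 (s\<^sup>2) * (1 + s)\<^sup>2 \<le> 36 * (x * y)" using xy by linarith
  then have "2 * min 1 (s\<^sup>2) \<le> 36 * (x * y) / (1 + s)\<^sup>2"
    using s by (simp add: pos_le_divide_eq)
  with 1 show ?thesis by (simp add: s_def)
qed

text \<open>The induction uses the superadditive potential instead of 36 N / N0, whose additivity
  would leave no room for the coefficients at the splits. The summand 2 belongs to the unthresholded
  first entry.\<close>

lemma sum_exp_threshold_le:
  assumes "N \<ge> 1" "N0 > 0"
  shows "(\<Sum>i\<in>{l..<l+N}. 2 * exp (- 3/8 * (threshold N0 (haar_length l N i))\<^sup>2)) \<le> 2 + 36 * (real N / N0)"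
proof -
  let ?g = "\<lambda>N. 36 * (real N / N0)\<^sup>2 / (1 + real N / N0)"
  let ?f = "\<lambda>(k::nat) (i::nat). 2 * exp (- 3/8 * (threshold N0 k)\<^sup>2)"
  have "(\<Sum>i\<in>{l..<l+N}. ?f (haar_length l N i) i) \<le> 2 + ?g N"
    using assms(1)
  proof (induction l N rule: halving_induct)
    case (base l N)
    then have "N = 1" by simp
    then show ?case using assms(2) by (simp add: haar_length_left threshold_0)
  next
    case (split l N)
    note h = haar_halves[OF split(1)]
    define p q where "p = N div 2" and "q = N - N div 2"
    have pq: "p \<ge> 1" "q \<ge> 1" "p + q = N" "3 * p \<le> 2 * N" "3 * q \<le> 2 * N"
      using h by (auto simp: p_def q_def)
    \<comment> \<open>As first entry of the right half, \<open>l + p\<close> contributed 2; this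
      smaller term replaces it.\<close>
    have "?f N (l + p) \<le> 2 * min 1 ((real p / N0 + real q / N0)\<^sup>2)"
      using exp_threshold_le[of N N0] split(1) assms(2) pq(3)
      by (simp add: add_divide_distrib[symmetric] of_nat_add[symmetric] del: of_nat_add)
    moreover have "?g p + ?g q + 2 * min 1 ((real p / N0 + real q / N0)\<^sup>2) \<le> ?g N"
    proof -
      have "real N / N0 = real p / N0 + real q / N0"
        unfolding pq(3)[symmetric] by (simp add: add_divide_distrib)
      then show ?thesis
        using superadditive_potential[of "real p / N0" "real q / N0"] pq assms(2)
        by (simp add: divide_right_mono)
    qed
    moreover have "(\<Sum>i\<in>{l..<l+p}. ?f (haar_length l p i) i) \<le> 2 + ?g p"
      using split(2) pq by (simp add: p_def)
    moreover have "(\<Sum>i\<in>{l+p..<l+p+q}. ?f (haar_length (l+p) q i) i) \<le> 2 + ?g q"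
      using split(3) pq by (simp add: p_def q_def)
    moreover have "?f 0 (l + p) = 2" using assms(2) by (simp add: threshold_0)
    ultimately show ?case
      unfolding sum_haar_length_split[OF split(1), of ?f]
      unfolding q_def[symmetric] unfolding p_def[symmetric]
      by linarith
  qed
  also have "36 * t\<^sup>2 / (1 + t) \<le> 36 * t" if "t \<ge> 0" for t :: real
    using that by (simp add: pos_divide_le_eq power2_eq_square algebra_simps)
  from this[of "real N / N0"] have "?g N \<le> 36 * (real N / N0)"
    using assms by simp
  finally show ?thesis by simp
qed

text \<open>The bound is proved with the extra factor min 1 (N / N0) to the power 1/4. Below
  \<open>N0\<close> this factor drops by at least (2/3)^(1/4) in passing to a half, which leaves
  room for the coefficient at the split; from \<open>N0\<close> on, the threshold is 0 and nothing
  is added.\<close>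

lemma sum_threshold_haar_le:
  assumes "N0 > 0"
  shows "(\<Sum>i\<in>{l..<l+N}. threshold N0 (haar_length l N i) * \<bar>haar l N x i\<bar>)
    \<le> 20 * sqrt N0 * block_variation l N x"
proof -
  let ?h = "\<lambda>N. sqrt (sqrt (min 1 (real N / N0)))"
  have h: "?h N \<ge> 0" for N using assms by simp
  have "(\<Sum>i\<in>{l..<l+N}. threshold N0 (haar_length l N i) * \<bar>haar l N x i\<bar>)
      \<le> 20 * sqrt N0 * ?h N * block_variation l N x"
  proof (induction l N arbitrary: x rule: halving_induct)
    case (base l N)
    then have "N = 0 \<or> N = 1" by auto
    then show ?case
      using assms by (auto simp: haar_length_left threshold_0 block_variation_def)
  next
    case (split l N)
    note hh = haar_halves[OF split(1)]
    define p q where "p = N div 2" and "q = N - N div 2"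
    have pq: "p \<ge> 1" "q \<ge> 1" "p + q = N" "3 * p \<le> 2 * N" "3 * q \<le> 2 * N"
      using hh by (auto simp: p_def q_def)
    then have eqN: "l + p + q = l + N" by simp
    define V where "V = block_variation l N x"
    define y where "y = haar (l + p) q x"
    define H where "H = sqrt (sqrt (min 1 (2/3 * (real N / N0))))"
    have H0: "H \<ge> 0" using assms by (simp add: H_def)
    have yl: "y i = x i" if "i < l + p" for i
      unfolding y_def using that by (intro haar_outside) auto
    have var_y: "block_variation l p y = block_variation l p x"
      unfolding block_variation_def using pq by (intro sum.cong) (auto simp: yl)
    have var: "block_variation l p x + block_variation (l + p) q x \<le> V"
    proof -
      have "block_variation l p x + block_variation (l + p) q x
          = (\<Sum>i\<in>{l..<l+p-1} \<union> {l+p..<l+p+q-1}. \<bar>x (Suc i) - x i\<bar>)"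
        unfolding block_variation_def by (intro sum.union_disjoint[symmetric]) auto
      also have "\<dots> \<le> V"
        unfolding V_def block_variation_def using pq by (intro sum_mono2) auto
      finally show ?thesis .
    qed
    have hHp: "?h p \<le> H" and hHq: "?h q \<le> H"
    proof -
      have "?h k \<le> H" if "3 * k \<le> 2 * N" for k
      proof -
        have "real k \<le> 2/3 * real N" using that by linarith
        then have "real k / N0 \<le> 2/3 * (real N / N0)"
          using divide_right_mono[of "real k" "2/3 * real N" N0] assms by simp
        then show ?thesis
          unfolding H_def by (intro real_sqrt_le_mono min.mono order.refl)
      qed
      then show "?h p \<le> H" "?h q \<le> H"
        using pq by blast+
    qed
    \<comment> \<open>The last rotation changes only the entries \<open>l\<close> and
      \<open>l + p\<close>, the first entries of the halves; there the halves' own thresholds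
      vanish.\<close>
    have outer: "\<bar>haar l N x i\<bar> = \<bar>haar l p y i\<bar>" if "i \<in> {l..<l+p}" "i \<noteq> l" for i
      using that split(1) by (simp add: haar.simps[of l N] rotation_def y_def p_def q_def)
    have left: "(\<Sum>i\<in>{l..<l+p}. threshold N0 (haar_length l p i) * \<bar>haar l N x i\<bar>)
        \<le> 20 * sqrt N0 * H * block_variation l p x"
    proof -
      have "(\<Sum>i\<in>{l..<l+p}. threshold N0 (haar_length l p i) * \<bar>haar l N x i\<bar>)
          = (\<Sum>i\<in>{l..<l+p}. threshold N0 (haar_length l p i) * \<bar>haar l p y i\<bar>)"
      proof (intro sum.cong refl)
        fix i assume "i \<in> {l..<l+p}"
        then show "threshold N0 (haar_length l p i) * \<bar>haar l N x i\<bar>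
            = threshold N0 (haar_length l p i) * \<bar>haar l p y i\<bar>"
          using outer[of i] assms by (cases "i = l") (auto simp: haar_length_left threshold_0)
      qed
      also have "\<dots> \<le> 20 * sqrt N0 * ?h p * block_variation l p y"
        using split(2)[of y] by (simp add: p_def)
      also have "\<dots> \<le> 20 * sqrt N0 * H * block_variation l p x"
        unfolding var_y using hHp assms
        by (intro mult_right_mono mult_left_mono block_variation_nonneg) auto
      finally show ?thesis .
    qed
    have right: "(\<Sum>i\<in>{l+p..<l+p+q}. threshold N0 (haar_length (l+p) q i) * \<bar>haar l N x i\<bar>)
        \<le> 20 * sqrt N0 * H * block_variation (l + p) q x"
    proof -
      have "(\<Sum>i\<in>{l+p..<l+p+q}. threshold N0 (haar_length (l+p) q i) * \<bar>haar l N x i\<bar>)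
          = (\<Sum>i\<in>{l+p..<l+p+q}. threshold N0 (haar_length (l+p) q i) * \<bar>haar (l+p) q x i\<bar>)"
      proof (intro sum.cong refl)
        fix i assume i: "i \<in> {l+p..<l+p+q}"
        have "haar l N x i = haar (l+p) q x i" if "i \<noteq> l + p"
          using that i split(1) pq(1)
          by (simp add: haar.simps[of l N] rotation_def p_def q_def haar_outside)
        then show "threshold N0 (haar_length (l+p) q i) * \<bar>haar l N x i\<bar>
            = threshold N0 (haar_length (l+p) q i) * \<bar>haar (l+p) q x i\<bar>"
          using assms by (cases "i = l + p") (auto simp: haar_length_left threshold_0)
      qed
      also have "\<dots> \<le> 20 * sqrt N0 * ?h q * block_variation (l + p) q x"
        using split(3)[of x] by (simp add: p_def q_def)
      also have "\<dots> \<le> 20 * sqrt N0 * H * block_variation (l + p) q x"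
        using hHq assms by (intro mult_right_mono mult_left_mono block_variation_nonneg) auto
      finally show ?thesis .
    qed
    have "(\<Sum>i\<in>{l..<l+N}. threshold N0 (haar_length l N i) * \<bar>haar l N x i\<bar>)
        \<le> 20 * sqrt N0 * H * (block_variation l p x + block_variation (l + p) q x)
           + threshold N0 N * \<bar>haar l N x (l + p)\<bar>"
      using left right assms
      unfolding sum_haar_length_split[OF split(1), of "\<lambda>k i. threshold N0 k * \<bar>haar l N x i\<bar>"]
        threshold_0[OF assms]
      unfolding q_def[symmetric] unfolding p_def[symmetric]
      by (simp add: algebra_simps)
    also have "\<dots> \<le> 20 * sqrt N0 * H * V + threshold N0 N * (sqrt (real N) / 2 * V)"
      using var haar_coeff_le_variation[of N l x] split(1) H0 assms
      by (intro add_mono mult_left_mono) (auto simp: threshold_nonneg p_def V_def)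
    also have "\<dots> \<le> 20 * sqrt N0 * ?h N * V"
    proof (cases "real N < N0")
      case True
      define r where "r = sqrt (sqrt (real N / N0))"
      have N: "real N > 0" using split(1) by simp
      have r: "r > 0" using N assms by (simp add: r_def)
      have "threshold N0 N = 3 * inverse r"
        using True by (simp add: threshold_def r_def real_sqrt_inverse[symmetric])
      moreover have "sqrt (real N) = sqrt N0 * (r * r)"
        using assms N by (simp add: r_def real_sqrt_divide)
      ultimately have t: "threshold N0 N * (sqrt (real N) / 2 * V) = 3/2 * (sqrt N0 * r * V)"
        using r by simp
      \<comment> \<open>The halves use 20 * 91/100 = 91/5 of the constant 20, and the new
        coefficient needs 3/2 more.\<close>
      have "sqrt (sqrt (2/3)) \<le> (91/100 :: real)"
        by (intro real_le_lsqrt) (simp_all add: power2_eq_square)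
      moreover have "H = sqrt (sqrt (2/3)) * r"
        using True assms N by (simp add: H_def r_def real_sqrt_mult[symmetric] field_simps min_def)
      ultimately have "H \<le> 91/100 * r" using r by simp
      then have "20 * sqrt N0 * H * V \<le> 20 * sqrt N0 * (91/100 * r) * V"
        using assms by (intro mult_right_mono mult_left_mono) (auto simp: V_def block_variation_nonneg)
      also have "\<dots> = 91/5 * (sqrt N0 * r * V)" by simp
      finally have "20 * sqrt N0 * H * V \<le> 91/5 * (sqrt N0 * r * V)" .
      moreover have hN: "?h N = r" using True assms by (simp add: r_def)
      moreover have "sqrt N0 * r * V \<ge> 0"
        using r assms by (simp add: V_def block_variation_nonneg)
      moreover have "20 * sqrt N0 * r * V = 20 * (sqrt N0 * r * V)" by simp
      ultimately show ?thesis unfolding t hN by linarith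
    next
      case False
      then have "?h N = 1" using assms by simp
      moreover have "H \<le> 1" by (simp add: H_def)
      then have "20 * sqrt N0 * H * V \<le> 20 * sqrt N0 * 1 * V"
        using assms by (intro mult_right_mono mult_left_mono) (auto simp: V_def block_variation_nonneg)
      ultimately show ?thesis using False by (simp add: threshold_def)
    qed
    finally show ?case by (simp add: V_def)
  qed
  also have "\<dots> \<le> 20 * sqrt N0 * 1 * block_variation l N x"
    using assms by (intro mult_right_mono mult_left_mono block_variation_nonneg) auto
  finally show ?thesis by simp
qed

section \<open>The good noise event\<close>

lemma (in prob_space) prob_ge_le_exp:
  assumes [measurable]: "X \<in> borel_measurable M"
    and X: "(\<integral>\<^sup>+z. ennreal (exp (X z)) \<partial>M) \<le> ennreal (exp S)"
  shows "prob {z \<in> space M. X z \<ge> S + t} \<le> exp (- t)"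
proof -
  have "emeasure M {z \<in> space M. X z \<ge> S + t}
      \<le> ennreal (exp (- (S + t))) * (\<integral>\<^sup>+z. ennreal (exp (X z)) \<partial>M)"
    using Chernoff_ineq_nn_integral_ge[of 1 "space M" M X "S + t"]
    by (simp add: nn_set_integral_space)
  also have "\<dots> \<le> ennreal (exp (- (S + t))) * ennreal (exp S)"
    by (intro mult_left_mono X) simp
  also have "\<dots> = ennreal (exp (- t))"
    by (simp add: ennreal_mult[symmetric] exp_add[symmetric])
  finally show ?thesis by (simp add: emeasure_eq_measure)
qed

text \<open>Either the excess vanishes and the left side is 1, or t < a, which gives (a - t)^2 <=
  a^2 - t^2.\<close>

lemma exp_soft_threshold_le:
  fixes a t :: real
  assumes "a \<ge> 0" "t \<ge> 0"
  shows "exp (3/8 * (max 0 (a - t))\<^sup>2) \<le> 1 + exp (- 3/8 * t\<^sup>2) * exp (3/8 * a\<^sup>2)"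
proof (cases "a \<le> t")
  case True
  then show ?thesis by simp
next
  case False
  then have "t * t \<le> a * t" using assms by (intro mult_right_mono) auto
  then have "(a - t)\<^sup>2 \<le> a\<^sup>2 - t\<^sup>2" by (simp add: power2_eq_square algebra_simps)
  then have "exp (3/8 * (max 0 (a - t))\<^sup>2) \<le> exp (- 3/8 * t\<^sup>2 + 3/8 * a\<^sup>2)"
    using False by (simp add: max_def)
  then show ?thesis unfolding exp_add by (simp add: add_increasing)
qed

definition haar_excess :: "nat \<Rightarrow> real \<Rightarrow> real \<Rightarrow> (nat \<Rightarrow> real) \<Rightarrow> nat \<Rightarrow> real" where
  "haar_excess n \<sigma> N0 z i = max 0 (\<bar>haar 1 n z i\<bar> / \<sigma> - threshold N0 (haar_length 1 n i))"

lemma measurable_centered_normal_component: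
  "i \<in> I \<Longrightarrow> (\<lambda>z. z i) \<in> borel_measurable (\<Pi>\<^sub>M i\<in>I. centered_normal \<sigma>)"
  using measurable_component_singleton[of i I "\<lambda>_. centered_normal \<sigma>"] by (simp add: measurable_def)

lemma measurable_haar_excess:
  assumes "i \<in> {1..n}"
  shows "(\<lambda>z. haar_excess n \<sigma> N0 z i) \<in> borel_measurable (gaussian_noise n \<sigma>)"
proof -
  have "{1..<1 + n} \<subseteq> {1..n}" by auto
  from measurable_compose[OF measurable_haar[OF this] measurable_centered_normal_component[OF assms]]
  have [measurable]: "(\<lambda>z. haar 1 n z i) \<in> borel_measurable (gaussian_noise n \<sigma>)"
    by (simp add: gaussian_noise_def)
  show ?thesis unfolding haar_excess_def by measurable
qed

text \<open>Invariance of the law replaces the coefficients by independent coordinates, so the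
  moment factorizes. Each factor is at most 1 + 2 exp (-3/8 t^2), and 1 + x <= exp x turns the
  product into the sum already bounded.\<close>

lemma nn_integral_exp_haar_excess_le:
  assumes "n \<ge> 1" "\<sigma> > 0" "N0 > 0"
  shows "(\<integral>\<^sup>+z. ennreal (exp (3/8 * (\<Sum>i\<in>{1..n}. (haar_excess n \<sigma> N0 z i)\<^sup>2))) \<partial>gaussian_noise n \<sigma>)
    \<le> ennreal (exp (2 + 36 * (real n / N0)))"
proof -
  interpret product_sigma_finite "\<lambda>_::nat. centered_normal \<sigma>"
    by (rule product_sigma_finite_centered_normal[OF assms(2)])
  interpret N: prob_space "centered_normal \<sigma>"
    by (rule prob_space_normal_density[OF assms(2)])
  define t where "t = (\<lambda>i. threshold N0 (haar_length 1 n i))"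
  have t0: "t i \<ge> 0" for i by (simp add: t_def threshold_nonneg)
  let ?g = "\<lambda>i x. ennreal (exp (3/8 * (max 0 (\<bar>x\<bar> / \<sigma> - t i))\<^sup>2))"
  have sub: "{1..<1 + n} \<subseteq> {1..n}" "{1..<1 + n} = {1..n}" by auto
  have [measurable]: "(\<lambda>z. z i) \<in> borel_measurable (\<Pi>\<^sub>M i\<in>{1..n}. centered_normal \<sigma>)" if "i \<in> {1..n}" for i
    by (rule measurable_centered_normal_component[OF that])
  have "(\<integral>\<^sup>+z. ennreal (exp (3/8 * (\<Sum>i\<in>{1..n}. (haar_excess n \<sigma> N0 z i)\<^sup>2))) \<partial>gaussian_noise n \<sigma>)
      = (\<integral>\<^sup>+z. (\<Prod>i\<in>{1..n}. ?g i (haar 1 n z i)) \<partial>(\<Pi>\<^sub>M i\<in>{1..n}. centered_normal \<sigma>))"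
    unfolding gaussian_noise_def
    by (intro nn_integral_cong)
      (simp add: sum_distrib_left exp_sum prod_ennreal haar_excess_def t_def)
  also have "\<dots> = (\<integral>\<^sup>+z. (\<Prod>i\<in>{1..n}. ?g i (z i)) \<partial>(\<Pi>\<^sub>M i\<in>{1..n}. centered_normal \<sigma>))"
    by (rule nn_integral_haar[where F = "\<lambda>z. \<Prod>i\<in>{1..n}. ?g i (z i)", OF assms(2) _ sub(1)])
      (simp, intro borel_measurable_prod_ennreal, measurable)
  also have "\<dots> = (\<Prod>i\<in>{1..n}. \<integral>\<^sup>+x. ?g i x \<partial>centered_normal \<sigma>)"
    by (rule product_nn_integral_prod) auto
  also have "\<dots> \<le> (\<Prod>i\<in>{1..n}. ennreal (exp (2 * exp (- 3/8 * (t i)\<^sup>2))))"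
  proof (intro prod_mono_ennreal)
    fix i
    have "(\<integral>\<^sup>+x. ?g i x \<partial>centered_normal \<sigma>)
        \<le> (\<integral>\<^sup>+x. 1 + ennreal (exp (- 3/8 * (t i)\<^sup>2)) * ennreal (exp (3/8 * (x/\<sigma>)\<^sup>2)) \<partial>centered_normal \<sigma>)"
    proof (rule nn_integral_mono)
      fix x
      have "?g i x \<le> ennreal (1 + exp (- 3/8 * (t i)\<^sup>2) * exp (3/8 * (\<bar>x\<bar>/\<sigma>)\<^sup>2))"
        using assms t0 by (intro ennreal_leI exp_soft_threshold_le) auto
      also have "\<dots> = 1 + ennreal (exp (- 3/8 * (t i)\<^sup>2)) * ennreal (exp (3/8 * (x/\<sigma>)\<^sup>2))"
        by (simp add: ennreal_plus ennreal_mult power_divide)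
      finally show "?g i x \<le> 1 + ennreal (exp (- 3/8 * (t i)\<^sup>2)) * ennreal (exp (3/8 * (x/\<sigma>)\<^sup>2))" .
    qed
    also have "\<dots> = 1 + ennreal (exp (- 3/8 * (t i)\<^sup>2)) * 2"
      using nn_integral_exp_square_normal[OF assms(2)] N.emeasure_space_1
      by (subst nn_integral_add) (auto simp: nn_integral_cmult)
    also have "\<dots> = ennreal (1 + 2 * exp (- 3/8 * (t i)\<^sup>2))"
      by (simp add: ennreal_plus ennreal_mult mult.commute)
    also have "\<dots> \<le> ennreal (exp (2 * exp (- 3/8 * (t i)\<^sup>2)))"
      by (intro ennreal_leI exp_ge_add_one_self)
    finally show "(\<integral>\<^sup>+x. ?g i x \<partial>centered_normal \<sigma>) \<le> ennreal (exp (2 * exp (- 3/8 * (t i)\<^sup>2)))" .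
  qed
  also have "\<dots> = ennreal (exp (\<Sum>i\<in>{1..n}. 2 * exp (- 3/8 * (t i)\<^sup>2)))"
    by (simp add: prod_ennreal exp_sum)
  also have "\<dots> \<le> ennreal (exp (2 + 36 * (real n / N0)))"
    using sum_exp_threshold_le[OF assms(1,3), of 1] unfolding sub t_def
    by (intro ennreal_leI) simp
  finally show ?thesis .
qed

text \<open>The signed sum, penalized by 7 per active coordinate, and the squared norm share one
  exponent, so a single tail bound yields a dichotomy between them. Each active factor is at most 2
  / e, so the size of the set costs nothing.\<close>

lemma nn_integral_exp_signed_le:
  fixes s :: "nat \<Rightarrow> real"
  assumes "\<sigma> > 0" and s: "\<And>i. s i \<in> {-1, 0, 1}"
  shows "(\<integral>\<^sup>+z. ennreal (exp (\<Sum>i\<in>{1..n}. \<bar>s i\<bar> * (s i * (z i/\<sigma>) - 7 + (z i/\<sigma>)\<^sup>2 / 3))) \<partial>gaussian_noise n \<sigma>)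
    \<le> 1"
proof -
  interpret product_sigma_finite "\<lambda>_::nat. centered_normal \<sigma>"
    by (rule product_sigma_finite_centered_normal[OF assms(1)])
  interpret N: prob_space "centered_normal \<sigma>"
    by (rule prob_space_normal_density[OF assms(1)])
  let ?g = "\<lambda>i x. ennreal (exp (\<bar>s i\<bar> * (s i * (x/\<sigma>) - 7 + (x/\<sigma>)\<^sup>2 / 3)))"
  have "(\<integral>\<^sup>+z. ennreal (exp (\<Sum>i\<in>{1..n}. \<bar>s i\<bar> * (s i * (z i/\<sigma>) - 7 + (z i/\<sigma>)\<^sup>2 / 3))) \<partial>gaussian_noise n \<sigma>)
      = (\<integral>\<^sup>+z. (\<Prod>i\<in>{1..n}. ?g i (z i)) \<partial>(\<Pi>\<^sub>M i\<in>{1..n}. centered_normal \<sigma>))"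
    unfolding gaussian_noise_def by (intro nn_integral_cong) (simp add: exp_sum prod_ennreal)
  also have "\<dots> = (\<Prod>i\<in>{1..n}. \<integral>\<^sup>+x. ?g i x \<partial>centered_normal \<sigma>)"
    by (rule product_nn_integral_prod) auto
  also have "\<dots> \<le> (\<Prod>i\<in>{1..n}. 1)"
  proof (intro prod_mono_ennreal)
    fix i
    show "(\<integral>\<^sup>+x. ?g i x \<partial>centered_normal \<sigma>) \<le> 1"
    proof (cases "s i = 0")
      case True
      then show ?thesis using N.emeasure_space_1 by simp
    next
      case False
      have "(\<integral>\<^sup>+x. ?g i x \<partial>centered_normal \<sigma>)
          \<le> (\<integral>\<^sup>+x. ennreal (exp (- 1)) * ennreal (exp (3/8 * (x/\<sigma>)\<^sup>2)) \<partial>centered_normal \<sigma>)"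
      proof (rule nn_integral_mono)
        fix x
        define g where "g = x / \<sigma>"
        \<comment> \<open>The square with 12 gives the bound g^2 / 24 + 6: then 1/3 + 1/24 = 3/8 is
          the exponent with known integral, and 6 - 7 = -1.\<close>
        have "0 \<le> (g - 12)\<^sup>2" "0 \<le> (g + 12)\<^sup>2" by simp_all
        then have "s i * g \<le> g\<^sup>2 / 24 + 6"
          using s[of i] False by (auto simp: power2_eq_square algebra_simps)
        then have "\<bar>s i\<bar> * (s i * g - 7 + g\<^sup>2 / 3) \<le> - 1 + 3/8 * g\<^sup>2"
          using s[of i] False by auto
        then have "exp (\<bar>s i\<bar> * (s i * g - 7 + g\<^sup>2 / 3)) \<le> exp (- 1) * exp (3/8 * g\<^sup>2)"
          by (simp add: exp_add[symmetric])
        then show "?g i x \<le> ennreal (exp (- 1)) * ennreal (exp (3/8 * (x/\<sigma>)\<^sup>2))"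
          by (simp add: g_def ennreal_mult[symmetric] ennreal_leI)
      qed
      also have "\<dots> = ennreal (exp (- 1)) * 2"
        using nn_integral_exp_square_normal[OF assms(1)] by (subst nn_integral_cmult) auto
      also have "\<dots> = ennreal (2 * exp (- 1))" by (simp add: ennreal_mult mult.commute)
      also have "\<dots> \<le> ennreal 1"
        using exp_ge_add_one_self[of 1] by (intro ennreal_leI) (simp add: exp_minus field_simps)
      finally show ?thesis by simp
    qed
  qed
  finally show ?thesis by simp
qed

text \<open>The possible signs of the clipped excess on a superlevel set: a unimodal sequence lies
  above a high level on an interval \<open>{p..q}\<close> and below a low level outside an interval
  \<open>{r..t}\<close>. Reversed endpoints encode an empty interval.\<close>

definition sign_pattern :: "nat \<Rightarrow> nat \<Rightarrow> nat \<Rightarrow> nat \<Rightarrow> nat \<Rightarrow> real" where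
  "sign_pattern p q r t i = (if i \<in> {p..q} then 1 else if i \<in> {r..t} then 0 else - 1)"

text \<open>Two exceptional events are removed, each of probability at most n^(-\<alpha>): a large
  Haar excess, and a failure of the dichotomy for some sign pattern, the latter by a union
  bound.\<close>

lemma good_noise_event:
  fixes \<alpha> \<sigma> N0 :: real
  assumes "n \<ge> 2" "\<sigma> > 0" "N0 > 0"
  obtains A where "A \<in> sets (gaussian_noise n \<sigma>)"
    "measure (gaussian_noise n \<sigma>) A \<ge> 1 - 2 * real n powr (- \<alpha>)"
    "\<And>z. z \<in> A \<Longrightarrow> (\<Sum>i\<in>{1..n}. (haar_excess n \<sigma> N0 z i)\<^sup>2) \<le> 8/3 * (2 + 36 * (real n / N0) + \<alpha> * ln (real n))"
    "\<And>z p q r t. z \<in> A \<Longrightarrow> {p, q, r, t} \<subseteq> {0..n} \<Longrightarrow>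
      (\<Sum>i\<in>{1..n}. \<bar>sign_pattern p q r t i\<bar> * (sign_pattern p q r t i * (z i / \<sigma>) - 7)) \<le> 0 \<or>
      (\<Sum>i\<in>{1..n}. \<bar>sign_pattern p q r t i\<bar> * (z i / \<sigma>)\<^sup>2) \<le> 3 * (\<alpha> + 8) * ln (real n)"
proof -
  define M where "M = gaussian_noise n \<sigma>"
  interpret prob_space M
    unfolding M_def by (rule prob_space_gaussian_noise[OF assms(2)])
  have [measurable]: "(\<lambda>z. z i) \<in> borel_measurable M" if "i \<in> {1..n}" for i
    unfolding M_def gaussian_noise_def by (rule measurable_centered_normal_component[OF that])
  have [measurable]: "(\<lambda>z. haar_excess n \<sigma> N0 z i) \<in> borel_measurable M" if "i \<in> {1..n}" for i
    unfolding M_def by (rule measurable_haar_excess[OF that])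
  have n_powr: "exp (- (a * ln (real n))) = real n powr (- a)" for a
    using assms(1) by (simp add: powr_def)

  define X where "X = (\<lambda>z. 3/8 * (\<Sum>i\<in>{1..n}. (haar_excess n \<sigma> N0 z i)\<^sup>2))"
  have [measurable]: "X \<in> borel_measurable M" unfolding X_def by measurable
  define S where "S = 2 + 36 * (real n / N0)"
  define B1 where "B1 = {z \<in> space M. X z \<ge> S + \<alpha> * ln (real n)}"
  have B1: "B1 \<in> events" "prob B1 \<le> real n powr (- \<alpha>)"
  proof -
    show "B1 \<in> events" unfolding B1_def by measurable
    have "(\<integral>\<^sup>+z. ennreal (exp (X z)) \<partial>M) \<le> ennreal (exp S)"
      unfolding X_def S_def M_def
      using assms by (intro nn_integral_exp_haar_excess_le) auto
    from prob_ge_le_exp[OF _ this, of "\<alpha> * ln (real n)"]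
    show "prob B1 \<le> real n powr (- \<alpha>)"
      unfolding n_powr B1_def by simp
  qed

  define Y where "Y = (\<lambda>(p, q, r, t) z. \<Sum>i\<in>{1..n}. \<bar>sign_pattern p q r t i\<bar> *
    (sign_pattern p q r t i * (z i/\<sigma>) - 7 + (z i/\<sigma>)\<^sup>2 / 3))"
  have Y_meas[measurable]: "Y k \<in> borel_measurable M" for k
    unfolding Y_def case_prod_beta by measurable
  define K where "K = {0..n} \<times> {0..n} \<times> {0..n} \<times> {0..n}"
  define E where "E = (\<lambda>k. {z \<in> space M. Y k z \<ge> 0 + (\<alpha> + 8) * ln (real n)})"
  define B2 where "B2 = (\<Union>k\<in>K. E k)"
  have E: "E k \<in> events" "prob (E k) \<le> real n powr (- (\<alpha> + 8))" for k
  proof -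
    show "E k \<in> events" unfolding E_def by measurable
    obtain p q r t where k: "k = (p, q, r, t)" by (cases k) auto
    have "(\<integral>\<^sup>+z. ennreal (exp (Y k z)) \<partial>M) \<le> ennreal (exp 0)"
      unfolding Y_def k M_def prod.case exp_zero ennreal_1
      by (rule nn_integral_exp_signed_le[OF assms(2)]) (simp add: sign_pattern_def)
    from prob_ge_le_exp[OF Y_meas this, of "(\<alpha> + 8) * ln (real n)"]
    show "prob (E k) \<le> real n powr (- (\<alpha> + 8))"
      unfolding n_powr E_def .
  qed
  have B2: "B2 \<in> events" "prob B2 \<le> real n powr (- \<alpha>)"
  proof -
    show "B2 \<in> events" unfolding B2_def K_def using E by (intro sets.finite_UN) auto
    have "prob B2 \<le> (\<Sum>k\<in>K. prob (E k))"
      unfolding B2_def K_def using E by (intro finite_measure_subadditive_finite) auto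
    also have "\<dots> \<le> real (card K) * real n powr (- (\<alpha> + 8))"
      using E(2) by (rule sum_bounded_above)
    also have "\<dots> \<le> real n ^ 8 * real n powr (- (\<alpha> + 8))"
    \<comment> \<open>There are (n + 1)^4 <= n^8 patterns because n >= 2; this is the source of the
      extra 8 in the exponent.\<close>
    proof (intro mult_right_mono)
      have "card K = (n + 1) ^ 4" by (simp add: K_def card_cartesian_product power4_eq_xxxx)
      also have "\<dots> \<le> (n * n) ^ 4"
      proof (rule power_mono)
        have "n + 1 \<le> 2 * n" using assms(1) by simp
        also have "\<dots> \<le> n * n" using assms(1) by (intro mult_right_mono) auto
        finally show "n + 1 \<le> n * n" .
      qed simp
      also have "\<dots> = n ^ 8" by (simp add: power_mult_distrib flip: power_add)
      finally show "real (card K) \<le> real n ^ 8" by (simp flip: of_nat_power)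
    qed simp
    also have "real n ^ 8 = real n powr 8" using assms(1) by (simp add: powr_numeral)
    also have "real n powr 8 * real n powr (- (\<alpha> + 8)) = real n powr (- \<alpha>)"
      unfolding powr_add[symmetric] by simp
    finally show "prob B2 \<le> real n powr (- \<alpha>)" .
  qed

  define A where "A = space M - (B1 \<union> B2)"
  have "prob A = 1 - prob (B1 \<union> B2)"
    unfolding A_def using B1(1) B2(1) by (intro prob_compl) auto
  moreover have "prob (B1 \<union> B2) \<le> prob B1 + prob B2"
    using B1(1) B2(1) by (rule measure_Un_le)
  ultimately have "prob A \<ge> 1 - 2 * real n powr (- \<alpha>)"
    using B1 B2 by linarith
  moreover have "A \<in> events" unfolding A_def using B1 B2 by auto
  moreover have "(\<Sum>i\<in>{1..n}. (haar_excess n \<sigma> N0 z i)\<^sup>2) \<le> 8/3 * (2 + 36 * (real n / N0) + \<alpha> * ln (real n))"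
    if "z \<in> A" for z
  proof -
    have "X z < S + \<alpha> * ln (real n)" using that by (auto simp: A_def B1_def)
    then show ?thesis by (simp add: X_def S_def)
  qed
  moreover have "(\<Sum>i\<in>{1..n}. \<bar>sign_pattern p q r t i\<bar> * (sign_pattern p q r t i * (z i / \<sigma>) - 7)) \<le> 0 \<or>
      (\<Sum>i\<in>{1..n}. \<bar>sign_pattern p q r t i\<bar> * (z i / \<sigma>)\<^sup>2) \<le> 3 * (\<alpha> + 8) * ln (real n)"
    if "z \<in> A" "{p, q, r, t} \<subseteq> {0..n}" for z p q r t
  proof -
    have "(p, q, r, t) \<in> K" using that(2) by (auto simp: K_def)
    then have "Y (p, q, r, t) z < (\<alpha> + 8) * ln (real n)"
      using that(1) by (fastforce simp: A_def B2_def E_def)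
    moreover have "Y (p, q, r, t) z
        = (\<Sum>i\<in>{1..n}. \<bar>sign_pattern p q r t i\<bar> * (sign_pattern p q r t i * (z i / \<sigma>) - 7))
          + (\<Sum>i\<in>{1..n}. \<bar>sign_pattern p q r t i\<bar> * (z i / \<sigma>)\<^sup>2) / 3"
      by (simp add: Y_def sum_divide_distrib sum.distrib[symmetric] distrib_left)
    \<comment> \<open>If the first sum is positive, one third of the second stays below (\<alpha> +
      8) ln n.\<close>
    ultimately show ?thesis by argo
  qed
  ultimately show ?thesis using that[of A] unfolding M_def by blast
qed

section \<open>Unimodal sequences\<close>

lemma unimodal_cone_increasing:
  assumes "\<theta> \<in> unimodal_cone n m" "1 \<le> i" "i \<le> j" "j \<le> m"
  shows "\<theta> i \<le> \<theta> j"
  using assms(3,4)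
proof (induction j rule: dec_induct)
  case (step k)
  then have "\<theta> k \<le> \<theta> (k + 1)"
    using assms(1,2) by (auto simp: unimodal_cone_def)
  with step show ?case by simp
qed simp

lemma unimodal_cone_decreasing:
  assumes "\<theta> \<in> unimodal_cone n m" "m \<le> i" "i \<le> j" "j \<le> n"
  shows "\<theta> j \<le> \<theta> i"
  using assms(3,4)
proof (induction j rule: dec_induct)
  case (step k)
  then have "\<theta> (k + 1) \<le> \<theta> k"
    using assms(1,2) by (auto simp: unimodal_cone_def)
  with step show ?case by simp
qed simp

text \<open>Up to the mode compare with the left point, beyond it with the right one. Hence
  superlevel sets are order-convex.\<close>

lemma unimodal_quasiconcave:
  assumes "\<theta> \<in> unimodal_seqs n" "1 \<le> i" "i \<le> j" "j \<le> k" "k \<le> n"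
  shows "min (\<theta> i) (\<theta> k) \<le> \<theta> j"
proof -
  obtain m where m: "\<theta> \<in> unimodal_cone n m" using assms(1) by (auto simp: unimodal_seqs_def)
  show ?thesis
    using unimodal_cone_increasing[OF m, of i j] unimodal_cone_decreasing[OF m, of j k] assms
    by (cases "j \<le> m") auto
qed

lemma order_convex_interval:
  fixes n :: nat and P :: "nat \<Rightarrow> bool"
  assumes "n \<ge> 1"
    and "\<And>i j k. 1 \<le> i \<Longrightarrow> i \<le> j \<Longrightarrow> j \<le> k \<Longrightarrow> k \<le> n \<Longrightarrow> P i \<Longrightarrow> P k \<Longrightarrow> P j"
  shows "\<exists>p\<in>{0..n}. \<exists>q\<in>{0..n}. \<forall>i\<in>{1..n}. i \<in> {p..q} \<longleftrightarrow> P i"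
proof (cases "\<exists>i\<in>{1..n}. P i")
  case False
  then have "\<forall>i\<in>{1..n}. i \<in> {1..0} \<longleftrightarrow> P i" by auto
  moreover have "1 \<in> {0..n}" "0 \<in> {0..n}" using assms(1) by auto
  ultimately show ?thesis by blast
next
  case True
  define S where "S = {i\<in>{1..n}. P i}"
  have S: "finite S" "S \<noteq> {}" using True by (auto simp: S_def)
  have "Min S \<in> S" "Max S \<in> S" using S by auto
  then have bounds: "1 \<le> Min S" "Max S \<le> n" "P (Min S)" "P (Max S)" by (auto simp: S_def)
  have "i \<in> {Min S..Max S} \<longleftrightarrow> P i" if "i \<in> {1..n}" for i
  proof
    assume "i \<in> {Min S..Max S}"
    then show "P i" using bounds by (intro assms(2)[of "Min S" i "Max S"]) auto
  next
    assume "P i"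
    with that have "i \<in> S" by (simp add: S_def)
    then show "i \<in> {Min S..Max S}" using S by simp
  qed
  moreover have "Min S \<in> {0..n}" "Max S \<in> {0..n}" using \<open>Min S \<in> S\<close> \<open>Max S \<in> S\<close> by (auto simp: S_def)
  ultimately show ?thesis by blast
qed

text \<open>Both monotone pieces telescope, so the variation is twice the value at the mode minus
  the two end values.\<close>

lemma unimodal_variation_le:
  assumes "\<theta> \<in> unimodal_seqs n" "\<And>i. i \<in> {1..n} \<Longrightarrow> a \<le> \<theta> i \<and> \<theta> i \<le> b"
  shows "block_variation 1 n \<theta> \<le> 2 * (b - a)"
proof -
  obtain m where m: "m \<in> {1..n}" "\<theta> \<in> unimodal_cone n m" using assms(1) by (auto simp: unimodal_seqs_def)
  have "block_variation 1 n \<theta> = (\<Sum>i\<in>{1..<m}. \<bar>\<theta> (Suc i) - \<theta> i\<bar>) + (\<Sum>i\<in>{m..<n}. \<bar>\<theta> (Suc i) - \<theta> i\<bar>)"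
    using m(1) by (simp add: block_variation_def sum.atLeastLessThan_concat)
  also have "(\<Sum>i\<in>{1..<m}. \<bar>\<theta> (Suc i) - \<theta> i\<bar>) = (\<Sum>i\<in>{1..<m}. \<theta> (Suc i) - \<theta> i)"
    using m(2) by (intro sum.cong) (auto simp: unimodal_cone_def)
  also have "\<dots> = \<theta> m - \<theta> 1" using m(1) by (intro sum_Suc_diff') auto
  also have "(\<Sum>i\<in>{m..<n}. \<bar>\<theta> (Suc i) - \<theta> i\<bar>) = (\<Sum>i\<in>{m..<n}. - (\<theta> (Suc i) - \<theta> i))"
    using m by (intro sum.cong) (auto simp: unimodal_cone_def)
  also have "\<dots> = - (\<theta> n - \<theta> m)"
    unfolding sum_negf using m(1) by (subst sum_Suc_diff') auto
  finally show ?thesis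
    using assms(2)[of 1] assms(2)[of m] assms(2)[of n] m(1) by simp
qed

lemma clip_unimodal:
  assumes "\<theta> \<in> unimodal_seqs n"
  shows "(\<lambda>i. max a (min b (\<theta> i))) \<in> unimodal_seqs n"
proof -
  obtain m where m: "m \<in> {1..n}" "\<theta> \<in> unimodal_cone n m" using assms(1) by (auto simp: unimodal_seqs_def)
  then have "(\<lambda>i. max a (min b (\<theta> i))) \<in> unimodal_cone n m"
    unfolding unimodal_cone_def by (auto intro!: max.mono min.mono)
  with m(1) show ?thesis by (auto simp: unimodal_seqs_def)
qed

lemma block_variation_diff_le:
  "block_variation l N (\<lambda>i. x i - y i) \<le> block_variation l N x + block_variation l N y"
  unfolding block_variation_def sum.distrib[symmetric] by (intro sum_mono) auto

section \<open>Deterministic bounds on the good event\<close>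

text \<open>Layers of \<open>e\<close> are peeled off from below, by induction on the size of its
  support. If \<open>z\<close> is small on the support, Cauchy-Schwarz finishes; otherwise the
  weights sum to at most 0 there, and lowering \<open>e\<close> by its least positive value does not
  decrease the inner product.\<close>

lemma inner_le_of_superlevel_sets:
  fixes e w z :: "'a \<Rightarrow> real"
  assumes "finite A" "\<And>i. i \<in> A \<Longrightarrow> e i \<ge> 0" "\<And>i. i \<in> A \<Longrightarrow> w i \<le> z i" "Z \<ge> 0"
    and "\<And>u. u \<ge> 0 \<Longrightarrow> sum w {i\<in>A. e i > u} \<le> 0 \<or> L2_set z {i\<in>A. e i > u} \<le> Z"
  shows "(\<Sum>i\<in>A. w i * e i) \<le> Z * L2_set e A"
  using assms(2,5)
proof (induction "card {i\<in>A. e i > 0}" arbitrary: e rule: less_induct)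
  case less
  define S where "S = {i\<in>A. e i > 0}"
  have S: "finite S" "S \<subseteq> A" using assms(1) by (auto simp: S_def)
  have e0: "e i = 0" if "i \<in> A - S" for i using that less.prems(1)[of i] by (auto simp: S_def)
  have sumS: "(\<Sum>i\<in>A. w i * e i) = (\<Sum>i\<in>S. w i * e i)"
    using S e0 assms(1) by (intro sum.mono_neutral_right) auto
  consider "S = {}" | "L2_set z S \<le> Z" | "S \<noteq> {}" "sum w S \<le> 0"
    using less.prems(2)[of 0] unfolding S_def by fastforce
  then show ?case
  proof cases
    case 1
    then show ?thesis using sumS assms(4) by (simp add: L2_set_nonneg)
  next
    case 2
    have "(\<Sum>i\<in>S. w i * e i) \<le> (\<Sum>i\<in>S. \<bar>z i\<bar> * \<bar>e i\<bar>)"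
    proof (rule sum_mono)
      fix i assume "i \<in> S"
      then have "w i * e i \<le> z i * e i"
        using assms(3)[of i] S(2) by (intro mult_right_mono) (auto simp: S_def)
      also have "\<dots> \<le> \<bar>z i * e i\<bar>" by (rule abs_ge_self)
      finally show "w i * e i \<le> \<bar>z i\<bar> * \<bar>e i\<bar>" by (simp add: abs_mult)
    qed
    also have "\<dots> \<le> L2_set z S * L2_set e S" by (rule L2_set_mult_ineq)
    also have "\<dots> \<le> Z * L2_set e A"
    proof (rule mult_mono)
      show "L2_set e S \<le> L2_set e A"
        using assms(1) S by (auto simp: L2_set_def intro!: sum_mono2)
    qed (use 2 assms(4) L2_set_nonneg in auto)
    finally show ?thesis using sumS by simp
  next
    case 3
    define m where "m = Min (e ` S)"
    have m: "m \<in> e ` S" unfolding m_def using S 3 by (intro Min_in) auto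
    then have m0: "m > 0" by (auto simp: S_def)
    have me: "m \<le> e i" if "i \<in> S" for i unfolding m_def using S that by simp
    define e' where "e' = (\<lambda>i. max 0 (e i - m))"
    have e'0: "e' i = 0" if "i \<in> A - S" for i using e0[OF that] m0 by (simp add: e'_def)
    \<comment> \<open>The superlevel sets of the lowered function are those of \<open>e\<close> at a
      shifted level, so the dichotomy is inherited.\<close>
    have lev: "{i\<in>A. e' i > u} = {i\<in>A. e i > u + m}" if "u \<ge> 0" for u
      using that by (auto simp: e'_def)
    obtain k where k: "k \<in> S" "e k = m" using m by auto
    have "{i\<in>A. e' i > 0} \<subset> {i\<in>A. e i > 0}"
    proof
      show "{i\<in>A. e' i > 0} \<subseteq> {i\<in>A. e i > 0}" using m0 by (auto simp: e'_def)
      have "k \<in> {i\<in>A. e i > 0}" "k \<notin> {i\<in>A. e' i > 0}" using k by (auto simp: S_def e'_def)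
      then show "{i\<in>A. e' i > 0} \<noteq> {i\<in>A. e i > 0}" by blast
    qed
    then have "card {i\<in>A. e' i > 0} < card {i\<in>A. e i > 0}"
      using assms(1) by (intro psubset_card_mono) auto
    then have IH: "(\<Sum>i\<in>A. w i * e' i) \<le> Z * L2_set e' A"
    proof (rule less.hyps)
      fix i show "e' i \<ge> 0" by (simp add: e'_def)
    next
      fix u :: real assume "u \<ge> 0"
      then show "sum w {i\<in>A. e' i > u} \<le> 0 \<or> L2_set z {i\<in>A. e' i > u} \<le> Z"
        using lev[of u] less.prems(2)[of "u + m"] m0 by simp
    qed
    have "(\<Sum>i\<in>S. w i * e i) = (\<Sum>i\<in>S. m * w i + w i * e' i)"
      using me by (intro sum.cong) (auto simp: e'_def max_def algebra_simps)
    also have "\<dots> = m * sum w S + (\<Sum>i\<in>A. w i * e' i)"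
    proof -
      have "(\<Sum>i\<in>A. w i * e' i) = (\<Sum>i\<in>S. w i * e' i)"
        using S e'0 assms(1) by (intro sum.mono_neutral_right) auto
      then show ?thesis by (simp add: sum.distrib sum_distrib_left)
    qed
    also have "\<dots> \<le> Z * L2_set e' A"
      using IH mult_nonneg_nonpos[of m "sum w S"] 3(2) m0 by linarith
    also have "\<dots> \<le> Z * L2_set e A"
      using m0 less.prems(1) assms(4) by (intro mult_left_mono L2_set_mono) (auto simp: e'_def)
    finally show ?thesis using sumS by simp
  qed
qed

text \<open>Layer peeling is applied to the absolute excess, with the noise multiplied by the sign
  of \<open>e\<close> and reduced by 7 \<sigma>; the reduction returns as the \<ell>1 term of the
  bound.\<close>

lemma inner_excess_le:
  assumes "n \<ge> 1" "\<sigma> > 0" "f \<in> unimodal_seqs n" "a \<le> b" "T \<ge> 0"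
    and good: "\<And>p q r t. {p, q, r, t} \<subseteq> {0..n} \<Longrightarrow>
      (\<Sum>i\<in>{1..n}. \<bar>sign_pattern p q r t i\<bar> * (sign_pattern p q r t i * (z i / \<sigma>) - 7)) \<le> 0 \<or>
      (\<Sum>i\<in>{1..n}. \<bar>sign_pattern p q r t i\<bar> * (z i / \<sigma>)\<^sup>2) \<le> T"
  defines "e \<equiv> \<lambda>i. f i - max a (min b (f i))"
  shows "(\<Sum>i\<in>{1..n}. z i * e i) \<le> \<sigma> * sqrt T * L2_set e {1..n} + 7 * \<sigma> * (\<Sum>i\<in>{1..n}. \<bar>e i\<bar>)"
proof -
  let ?A = "{1..n}"
  define w where "w = (\<lambda>i. sgn (e i) * z i - 7 * \<sigma>)"
  have "(\<Sum>i\<in>?A. w i * \<bar>e i\<bar>) \<le> (\<sigma> * sqrt T) * L2_set (\<lambda>i. \<bar>e i\<bar>) ?A"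
  proof (rule inner_le_of_superlevel_sets[where z = "\<lambda>i. sgn (e i) * z i"])
    fix u :: real assume u: "u \<ge> 0"
    obtain p q where pq: "p \<in> {0..n}" "q \<in> {0..n}" "\<forall>i\<in>?A. i \<in> {p..q} \<longleftrightarrow> f i > b + u"
      using order_convex_interval[OF assms(1), of "\<lambda>i. f i > b + u"]
        unimodal_quasiconcave[OF assms(3)] by (smt (verit, best))
    obtain r t where rt: "r \<in> {0..n}" "t \<in> {0..n}" "\<forall>i\<in>?A. i \<in> {r..t} \<longleftrightarrow> f i \<ge> a - u"
      using order_convex_interval[OF assms(1), of "\<lambda>i. f i \<ge> a - u"]
        unimodal_quasiconcave[OF assms(3)] by (smt (verit, best))
    let ?s = "sign_pattern p q r t"
    let ?I = "{i\<in>?A. \<bar>e i\<bar> > u}"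
    \<comment> \<open>The set where the excess exceeds \<open>u\<close> in absolute value splits
      into f > b + u and f < a - u, disjoint because \<open>a \<le> b\<close> and
      \<open>u \<ge> 0\<close>.\<close>
    have s: "?s i = (if \<bar>e i\<bar> > u then sgn (e i) else 0)" if "i \<in> ?A" for i
    proof -
      have "i \<in> {p..q} \<longleftrightarrow> f i > b + u" "i \<in> {r..t} \<longleftrightarrow> f i \<ge> a - u"
        using pq(3) rt(3) that by auto
      then show ?thesis
        using u assms(4) unfolding sign_pattern_def e_def by (auto simp: max_def min_def)
    qed
    have abs_s: "\<bar>?s i\<bar> = (if \<bar>e i\<bar> > u then 1 else 0)" if "i \<in> ?A" for i
      using s[OF that] u by (auto simp: sgn_if)
    have 1: "(\<Sum>i\<in>?A. \<bar>?s i\<bar> * (?s i * (z i / \<sigma>) - 7)) = sum w ?I / \<sigma>"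
    proof -
      have "(\<Sum>i\<in>?A. \<bar>?s i\<bar> * (?s i * (z i / \<sigma>) - 7)) = (\<Sum>i\<in>?A. if \<bar>e i\<bar> > u then w i / \<sigma> else 0)"
        using assms(2) u by (intro sum.cong) (auto simp: s abs_s w_def diff_divide_distrib)
      also have "\<dots> = (\<Sum>i\<in>?I. w i / \<sigma>)" by (rule sum.inter_filter[symmetric]) simp
      finally show ?thesis by (simp add: sum_divide_distrib)
    qed
    have 2: "L2_set (\<lambda>i. sgn (e i) * z i) ?I = \<sigma> * sqrt (\<Sum>i\<in>?A. \<bar>?s i\<bar> * (z i / \<sigma>)\<^sup>2)"
    proof -
      have "(\<Sum>i\<in>?A. \<bar>?s i\<bar> * (z i / \<sigma>)\<^sup>2)
          = (\<Sum>i\<in>?A. if \<bar>e i\<bar> > u then (sgn (e i) * z i)\<^sup>2 / \<sigma>\<^sup>2 else 0)"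
        using u by (intro sum.cong) (auto simp: abs_s power_divide sgn_if)
      also have "\<dots> = (\<Sum>i\<in>?I. (sgn (e i) * z i)\<^sup>2 / \<sigma>\<^sup>2)" by (rule sum.inter_filter[symmetric]) simp
      also have "\<dots> = (\<Sum>i\<in>?I. (sgn (e i) * z i)\<^sup>2) / \<sigma>\<^sup>2" by (simp add: sum_divide_distrib)
      finally show ?thesis
        using assms(2) by (simp add: L2_set_def real_sqrt_divide)
    qed
    show "sum w ?I \<le> 0 \<or> L2_set (\<lambda>i. sgn (e i) * z i) ?I \<le> \<sigma> * sqrt T"
      using good[of p q r t] pq(1,2) rt(1,2) assms(2) unfolding 1 2
      by (auto simp: divide_le_0_iff)
  qed (use assms in \<open>auto simp: w_def\<close>)
  moreover have "w i * \<bar>e i\<bar> = z i * e i - 7 * \<sigma> * \<bar>e i\<bar>" for i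
    by (simp add: w_def sgn_if abs_if algebra_simps)
  ultimately show ?thesis
    by (simp add: sum_subtractf sum_distrib_left[symmetric] L2_set_def)
qed

text \<open>By Parseval's identity the pairing passes to Haar coefficients. The part of the noise
  below the threshold meets the \<ell>1 bound by variation, the excess is treated by
  Cauchy-Schwarz.\<close>

lemma inner_bounded_variation_le:
  assumes "n \<ge> 1" "\<sigma> > 0" "N0 > 0" "(\<Sum>i\<in>{1..n}. (haar_excess n \<sigma> N0 z i)\<^sup>2) \<le> R"
  shows "(\<Sum>i\<in>{1..n}. z i * g i)
    \<le> \<sigma> * (20 * sqrt N0 * block_variation 1 n g) + \<sigma> * sqrt R * L2_set g {1..n}"
proof -
  have A: "{1..<1 + n} = {1..n}" by auto
  let ?t = "\<lambda>i. threshold N0 (haar_length 1 n i)" and ?r = "haar_excess n \<sigma> N0 z"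
  have "(\<Sum>i\<in>{1..n}. z i * g i) = (\<Sum>i\<in>{1..n}. haar 1 n z i * haar 1 n g i)"
    using haar_inner[of 1 n z g] unfolding A by simp
  also have "\<dots> \<le> (\<Sum>i\<in>{1..n}. \<sigma> * (?t i * \<bar>haar 1 n g i\<bar>) + \<sigma> * (\<bar>?r i\<bar> * \<bar>haar 1 n g i\<bar>))"
  proof (rule sum_mono)
    fix i
    have "\<bar>haar 1 n z i\<bar> / \<sigma> \<le> ?t i + \<bar>?r i\<bar>" by (simp add: haar_excess_def)
    then have "\<bar>haar 1 n z i\<bar> \<le> \<sigma> * (?t i + \<bar>?r i\<bar>)"
      using assms(2) by (simp add: pos_divide_le_eq mult.commute)
    then have "\<bar>haar 1 n z i\<bar> * \<bar>haar 1 n g i\<bar> \<le> \<sigma> * (?t i + \<bar>?r i\<bar>) * \<bar>haar 1 n g i\<bar>"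
      by (rule mult_right_mono) simp
    moreover have "haar 1 n z i * haar 1 n g i \<le> \<bar>haar 1 n z i\<bar> * \<bar>haar 1 n g i\<bar>"
      unfolding abs_mult[symmetric] by (rule abs_ge_self)
    ultimately show "haar 1 n z i * haar 1 n g i
        \<le> \<sigma> * (?t i * \<bar>haar 1 n g i\<bar>) + \<sigma> * (\<bar>?r i\<bar> * \<bar>haar 1 n g i\<bar>)"
      by (simp add: algebra_simps)
  qed
  also have "\<dots> = \<sigma> * (\<Sum>i\<in>{1..n}. ?t i * \<bar>haar 1 n g i\<bar>) + \<sigma> * (\<Sum>i\<in>{1..n}. \<bar>?r i\<bar> * \<bar>haar 1 n g i\<bar>)"
    by (simp add: sum.distrib sum_distrib_left)
  also have "\<dots> \<le> \<sigma> * (20 * sqrt N0 * block_variation 1 n g) + \<sigma> * (sqrt R * L2_set g {1..n})"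
  proof (intro add_mono mult_left_mono)
    show "(\<Sum>i\<in>{1..n}. ?t i * \<bar>haar 1 n g i\<bar>) \<le> 20 * sqrt N0 * block_variation 1 n g"
      using sum_threshold_haar_le[OF assms(3), of 1 n g] unfolding A .
    have "L2_set (haar 1 n g) {1..n} = L2_set g {1..n}"
      using haar_inner[of 1 n g g] unfolding A L2_set_def by (simp add: power2_eq_square)
    moreover have "L2_set ?r {1..n} \<le> sqrt R"
      using assms(4) by (simp add: L2_set_def)
    ultimately show "(\<Sum>i\<in>{1..n}. \<bar>?r i\<bar> * \<bar>haar 1 n g i\<bar>) \<le> sqrt R * L2_set g {1..n}"
      using L2_set_mult_ineq[where f = ?r and g = "haar 1 n g" and A = "{1..n}"]
        mult_right_mono[OF _ L2_set_nonneg[of g "{1..n}"], of "L2_set ?r {1..n}" "sqrt R"]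
      by simp
  qed (use assms in auto)
  finally show ?thesis by simp
qed

text \<open>After Young's inequality the right side contains half of each squared norm of
  \<open>g\<close> and \<open>e\<close> and 14 \<sigma> times the \<ell>1 norm of \<open>e\<close>,
  together at most half of the error. Absorbing this half doubles the constants 2 and 2240.\<close>

lemma LSE_error_le:
  assumes n: "n \<ge> 1" and \<sigma>: "\<sigma> > 0" and N0: "N0 > 0" and T: "T \<ge> 0"
    and \<theta>: "\<theta> \<in> unimodal_seqs n" and f: "is_LSE n (\<lambda>i. \<theta> i + z i) f"
    and R: "(\<Sum>i\<in>{1..n}. (haar_excess n \<sigma> N0 z i)\<^sup>2) \<le> R"
    and good: "\<And>p q r t. {p, q, r, t} \<subseteq> {0..n} \<Longrightarrow>
      (\<Sum>i\<in>{1..n}. \<bar>sign_pattern p q r t i\<bar> * (sign_pattern p q r t i * (z i / \<sigma>) - 7)) \<le> 0 \<or>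
      (\<Sum>i\<in>{1..n}. \<bar>sign_pattern p q r t i\<bar> * (z i / \<sigma>)\<^sup>2) \<le> T"
  shows "(eucl_norm n (\<lambda>i. f i - \<theta> i))\<^sup>2
    \<le> 4 * \<sigma>\<^sup>2 * (R + T) + 4480 * (\<sigma> * sqrt N0 * (total_range n \<theta> + \<sigma>))"
proof -
  let ?A = "{1..n}"
  define V where "V = total_range n \<theta>"
  \<comment> \<open>The margin 14 is twice 7: half of the gain 28 \<sigma> per unit of excess then
    cancels the term 2 * 7 \<sigma> from the noise bound.\<close>
  define lo hi where "lo = Min (\<theta> ` ?A) - 14 * \<sigma>" and "hi = Max (\<theta> ` ?A) + 14 * \<sigma>"
  have \<theta>_le: "lo + 14 * \<sigma> \<le> \<theta> i" "\<theta> i \<le> hi - 14 * \<sigma>" if "i \<in> ?A" for i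
    using that by (auto simp: lo_def hi_def)
  have V: "hi - lo = V + 28 * \<sigma>" by (simp add: hi_def lo_def V_def total_range_def)
  have lohi: "lo \<le> hi" using \<theta>_le[of 1] n \<sigma> by simp
  have V0: "V \<ge> 0" using \<theta>_le[of 1] n V by simp
  define d where "d = (\<lambda>i. f i - \<theta> i)"
  define \<phi> where "\<phi> = (\<lambda>i. max lo (min hi (f i)))"
  define e where "e = (\<lambda>i. f i - \<phi> i)"
  define g where "g = (\<lambda>i. \<phi> i - \<theta> i)"
  have fU: "f \<in> unimodal_seqs n"
    and fmin: "\<not> (eucl_norm n (\<lambda>i. \<theta> i + z i - \<theta> i))\<^sup>2 < (eucl_norm n (\<lambda>i. \<theta> i + z i - f i))\<^sup>2"
    using f \<theta> by (auto simp: is_LSE_def is_arg_min_def)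
  have sq: "(L2_set x ?A)\<^sup>2 = (\<Sum>i\<in>?A. (x i)\<^sup>2)" for x
    by (simp add: L2_set_def sum_nonneg)
  have basic: "(\<Sum>i\<in>?A. (d i)\<^sup>2) \<le> 2 * (\<Sum>i\<in>?A. z i * d i)"
  proof -
    \<comment> \<open>Minimality is tested against the true sequence, itself unimodal.\<close>
    have "(\<Sum>i\<in>?A. (z i - d i)\<^sup>2) \<le> (\<Sum>i\<in>?A. (z i)\<^sup>2)"
      using fmin unfolding eucl_norm_def sq by (simp add: d_def algebra_simps)
    moreover have "(\<Sum>i\<in>?A. (z i - d i)\<^sup>2) = (\<Sum>i\<in>?A. (z i)\<^sup>2 - 2 * (z i * d i) + (d i)\<^sup>2)"
      by (intro sum.cong refl) (simp add: power2_eq_square algebra_simps)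
    ultimately show ?thesis
      by (simp add: sum.distrib sum_subtractf sum_distrib_left)
  qed
  have de: "d i = g i + e i" for i by (simp add: d_def g_def e_def)
  have zd: "(\<Sum>i\<in>?A. z i * d i) = (\<Sum>i\<in>?A. z i * g i) + (\<Sum>i\<in>?A. z i * e i)"
    by (simp add: de distrib_left sum.distrib)
  text \<open>Clipping at distance \<open>14 \<sigma>\<close> outside the range of \<open>\<theta>\<close> makes \<open>g i\<close> and \<open>e i\<close> have equal signs
    and \<open>\<bar>g i\<bar> \<ge> 14 \<sigma>\<close> wherever \<open>e i \<noteq> 0\<close>.\<close>
  have lower: "(\<Sum>i\<in>?A. (g i)\<^sup>2) + (\<Sum>i\<in>?A. (e i)\<^sup>2) + 28 * \<sigma> * (\<Sum>i\<in>?A. \<bar>e i\<bar>) \<le> (\<Sum>i\<in>?A. (d i)\<^sup>2)"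
  proof -
    have "(g i)\<^sup>2 + (e i)\<^sup>2 + 28 * \<sigma> * \<bar>e i\<bar> \<le> (d i)\<^sup>2" if i: "i \<in> ?A" for i
    proof -
      have "14 * \<sigma> * \<bar>e i\<bar> \<le> g i * e i"
      proof -
        consider "e i = 0" | "e i > 0" "g i \<ge> 14 * \<sigma>" | "e i < 0" "g i \<le> - (14 * \<sigma>)"
        proof -
          consider "f i > hi" | "f i < lo" | "lo \<le> f i" "f i \<le> hi" by linarith
          then show thesis
            using that \<theta>_le[OF i] lohi by cases (auto simp: e_def g_def \<phi>_def)
        qed
        then show ?thesis
        proof cases
          case 2
          then show ?thesis by (simp add: mult_right_mono)
        next
          case 3
          then show ?thesis using mult_right_mono_neg[of "g i" "- (14 * \<sigma>)" "e i"] by simp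
        qed simp
      qed
      then show ?thesis by (simp add: de power2_eq_square algebra_simps)
    qed
    then show ?thesis
      unfolding sum_distrib_left sum.distrib[symmetric] by (intro sum_mono)
  qed
  have ze: "(\<Sum>i\<in>?A. z i * e i) \<le> \<sigma> * sqrt T * L2_set e ?A + 7 * \<sigma> * (\<Sum>i\<in>?A. \<bar>e i\<bar>)"
    unfolding e_def \<phi>_def using good by (intro inner_excess_le n \<sigma> fU lohi T) blast
  have var: "block_variation 1 n g \<le> 56 * (V + \<sigma>)"
  proof -
    have "block_variation 1 n \<phi> \<le> 2 * (hi - lo)"
      unfolding \<phi>_def using lohi by (intro unimodal_variation_le clip_unimodal fU) auto
    moreover have "block_variation 1 n \<theta> \<le> 2 * ((hi - 14 * \<sigma>) - (lo + 14 * \<sigma>))"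
      using \<theta>_le by (intro unimodal_variation_le \<theta>) auto
    moreover have "block_variation 1 n g \<le> block_variation 1 n \<phi> + block_variation 1 n \<theta>"
      unfolding g_def by (rule block_variation_diff_le)
    \<comment> \<open>The two bounds add up to 2 (V + 28 \<sigma>) + 2 V = 4 V + 56
      \<sigma>.\<close>
    ultimately show ?thesis using V V0 by (simp add: algebra_simps)
  qed
  have zg: "(\<Sum>i\<in>?A. z i * g i) \<le> 1120 * (\<sigma> * sqrt N0 * (V + \<sigma>)) + \<sigma> * sqrt R * L2_set g ?A"
  proof -
    have "\<sigma> * (20 * sqrt N0 * block_variation 1 n g) \<le> \<sigma> * (20 * sqrt N0 * (56 * (V + \<sigma>)))"
      using var \<sigma> N0 by (intro mult_left_mono) auto
    then show ?thesis using inner_bounded_variation_le[OF n \<sigma> N0 R, of g] by (simp add: mult_ac)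
  qed
  have R0: "R \<ge> 0" using R by (intro order_trans[OF _ R] sum_nonneg) simp
  have young: "2 * (\<sigma> * sqrt x * y) \<le> 2 * \<sigma>\<^sup>2 * x + y\<^sup>2 / 2" if "x \<ge> 0" for x y
  proof -
    have "0 \<le> (2 * (\<sigma> * sqrt x) - y)\<^sup>2" by simp
    also have "\<dots> = 4 * \<sigma>\<^sup>2 * (sqrt x)\<^sup>2 - 4 * (\<sigma> * sqrt x * y) + y\<^sup>2"
      by (simp add: power2_eq_square algebra_simps)
    finally show ?thesis using that by simp
  qed
  have "(\<Sum>i\<in>?A. (d i)\<^sup>2) \<le> 4 * \<sigma>\<^sup>2 * (R + T) + 4480 * (\<sigma> * sqrt N0 * (V + \<sigma>))"
    using basic zd lower ze zg young[OF R0, of "L2_set g ?A"] young[OF T, of "L2_set e ?A"]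
    unfolding sq by (simp add: algebra_simps)
  then show ?thesis unfolding eucl_norm_def sq d_def V_def .
qed

section \<open>Choice of the critical length and the final bound\<close>

theorem theorem2p1:
  "\<exists>C::real. C > 0 \<and>
    (\<forall>(n::nat) (\<theta>::nat \<Rightarrow> real) (\<sigma>::real) (\<theta>hat::(nat \<Rightarrow> real) \<Rightarrow> (nat \<Rightarrow> real)) (\<alpha>::real).
      n \<ge> 1 \<longrightarrow> \<theta> \<in> unimodal_seqs n \<longrightarrow> \<sigma> > 0 \<longrightarrow> (\<forall>y. is_LSE n y (\<theta>hat y)) \<longrightarrow> \<alpha> > 0 \<longrightarrow>
      holds_with_prob_at_least (gaussian_noise n \<sigma>) (1 - 2 * real n powr (- \<alpha>))
        (\<lambda>z. let y = (\<lambda>i. \<theta> i + z i) in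
          (1 / real n) * (eucl_norm n (\<lambda>i. \<theta>hat y i - \<theta> i))\<^sup>2
            \<le> C * \<sigma> powr (4/3) * (total_range n \<theta> + \<sigma>) powr (2/3) * real n powr (- 2/3)
              + (C + 24 * \<alpha>) * \<sigma>\<^sup>2 * (ln (real n) / real n)))"
proof (intro exI[of _ 5000] conjI allI impI)
  fix n :: nat and \<theta> :: "nat \<Rightarrow> real" and \<sigma> \<alpha> :: real and \<theta>hat :: "(nat \<Rightarrow> real) \<Rightarrow> (nat \<Rightarrow> real)"
  assume n: "n \<ge> 1" and \<theta>: "\<theta> \<in> unimodal_seqs n" and \<sigma>: "\<sigma> > 0"
    and lse: "\<forall>y. is_LSE n y (\<theta>hat y)" and \<alpha>: "\<alpha> > 0"
  define V where "V = total_range n \<theta>"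
  define Q where "Q = \<sigma> powr (4/3) * (V + \<sigma>) powr (2/3) * real n powr (- 2/3)"
  let ?P = "\<lambda>z. (1 / real n) * (eucl_norm n (\<lambda>i. \<theta>hat (\<lambda>i. \<theta> i + z i) i - \<theta> i))\<^sup>2
      \<le> 5000 * Q + (5000 + 24 * \<alpha>) * \<sigma>\<^sup>2 * (ln (real n) / real n)"
  have "holds_with_prob_at_least (gaussian_noise n \<sigma>) (1 - 2 * real n powr (- \<alpha>)) ?P"
  proof (cases "n = 1")
    case True
    \<comment> \<open>The required probability is 1 - 2 = -1, so the empty event serves.\<close>
    then show ?thesis
      unfolding holds_with_prob_at_least_def by (intro bexI[of _ "{}"]) auto
  next
    case False
    then have n2: "n \<ge> 2" using n by simp
    have "V \<ge> 0"
      unfolding V_def total_range_def using n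
      by (auto intro!: order_trans[OF Min_le[of _ "\<theta> 1"] Max_ge[of _ "\<theta> 1"]])
    then have V\<sigma>: "V + \<sigma> > 0" "\<sigma> \<le> V + \<sigma>" using \<sigma> by auto
    text \<open>This choice of \<open>N0\<close> balances \<open>n \<sigma>\<^sup>2 / N0\<close> and \<open>\<sigma> (V + \<sigma>) sqrt N0\<close>.\<close>
    define N0 where "N0 = (real n * \<sigma> / (V + \<sigma>)) powr (2/3)"
    have N0: "N0 > 0" using n \<sigma> V\<sigma> by (simp add: N0_def)
    define L where "L = ln (real n)"
    have L: "L \<ge> 0" using n by (simp add: L_def)
    \<comment> \<open>The balancing identities are checked on logarithms, where real powers become
      linear.\<close>
    have lnN0: "ln N0 = 2/3 * (L + ln \<sigma> - ln (V + \<sigma>))"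
      using n \<sigma> V\<sigma> by (simp add: N0_def ln_powr ln_mult ln_div L_def)
    have Q0: "Q > 0" using n \<sigma> V\<sigma> by (simp add: Q_def)
    have lnQ: "ln Q = 4/3 * ln \<sigma> + 2/3 * ln (V + \<sigma>) - 2/3 * L"
      using n \<sigma> V\<sigma> by (simp add: Q_def ln_powr ln_mult L_def)
    have eq1: "\<sigma>\<^sup>2 / N0 = Q"
    proof -
      have "ln (\<sigma>\<^sup>2 / N0) = 2 * ln \<sigma> - ln N0"
        using \<sigma> N0 by (simp add: ln_div ln_realpow)
      then have "ln (\<sigma>\<^sup>2 / N0) = ln Q" using lnQ lnN0 by argo
      then show ?thesis using \<sigma> N0 Q0 by (simp add: ln_inj_iff)
    qed
    have eq2: "\<sigma> * sqrt N0 * (V + \<sigma>) = real n * Q"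
    proof -
      have "ln (\<sigma> * sqrt N0 * (V + \<sigma>)) = ln \<sigma> + ln N0 / 2 + ln (V + \<sigma>)"
        using \<sigma> V\<sigma> N0 by (simp add: ln_mult ln_sqrt)
      moreover have "ln (real n * Q) = L + ln Q"
        using n Q0 by (simp add: ln_mult L_def)
      ultimately have "ln (\<sigma> * sqrt N0 * (V + \<sigma>)) = ln (real n * Q)"
        using lnQ lnN0 by argo
      then show ?thesis using n \<sigma> V\<sigma> N0 Q0 by (simp add: ln_inj_iff)
    qed
    \<comment> \<open>This absorbs the stray \<sigma>^2, left by the constant 2 in the excess bound,
      into n Q.\<close>
    have "N0 \<le> real n"
    proof -
      have "ln \<sigma> \<le> ln (V + \<sigma>)" using \<sigma> V\<sigma> by simp
      then have "ln N0 \<le> ln (real n)" using L by (simp add: lnN0 L_def[symmetric])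
      then show ?thesis using n N0 by simp
    qed
    then have \<sigma>Q: "\<sigma>\<^sup>2 \<le> real n * Q"
      using N0 \<sigma> by (simp add: eq1[symmetric] pos_le_divide_eq mult.commute)
    define R T where "R = 8/3 * (2 + 36 * (real n / N0) + \<alpha> * L)" and "T = 3 * (\<alpha> + 8) * L"
    have T0: "T \<ge> 0" using \<alpha> L by (simp add: T_def)
    obtain A where A: "A \<in> sets (gaussian_noise n \<sigma>)"
      "measure (gaussian_noise n \<sigma>) A \<ge> 1 - 2 * real n powr (- \<alpha>)"
      "\<And>z. z \<in> A \<Longrightarrow> (\<Sum>i\<in>{1..n}. (haar_excess n \<sigma> N0 z i)\<^sup>2) \<le> R"
      "\<And>z p q r t. z \<in> A \<Longrightarrow> {p, q, r, t} \<subseteq> {0..n} \<Longrightarrow>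
        (\<Sum>i\<in>{1..n}. \<bar>sign_pattern p q r t i\<bar> * (sign_pattern p q r t i * (z i / \<sigma>) - 7)) \<le> 0 \<or>
        (\<Sum>i\<in>{1..n}. \<bar>sign_pattern p q r t i\<bar> * (z i / \<sigma>)\<^sup>2) \<le> T"
      using good_noise_event[OF n2 \<sigma> N0, of \<alpha>] unfolding R_def T_def L_def by blast
    have "?P z" if z: "z \<in> A" for z
    proof -
      let ?D = "(eucl_norm n (\<lambda>i. \<theta>hat (\<lambda>i. \<theta> i + z i) i - \<theta> i))\<^sup>2"
      have "?D \<le> 4 * \<sigma>\<^sup>2 * (R + T) + 4480 * (real n * Q)"
        using LSE_error_le[OF n \<sigma> N0 T0 \<theta> lse[rule_format] A(3)[OF z] A(4)[OF z]]
        by (simp add: eq2 V_def[symmetric])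
      also have "4 * \<sigma>\<^sup>2 * (R + T)
          = 64/3 * \<sigma>\<^sup>2 + 384 * (real n * (\<sigma>\<^sup>2 / N0)) + (68/3 * \<alpha> + 96) * (\<sigma>\<^sup>2 * L)"
        by (simp add: R_def T_def algebra_simps)
      also have "\<dots> \<le> 64/3 * (real n * Q) + 384 * (real n * Q) + (5000 + 24 * \<alpha>) * (\<sigma>\<^sup>2 * L)"
      proof -
        have "(68/3 * \<alpha> + 96) * (\<sigma>\<^sup>2 * L) \<le> (5000 + 24 * \<alpha>) * (\<sigma>\<^sup>2 * L)"
          using \<alpha> L by (intro mult_right_mono) auto
        with \<sigma>Q show ?thesis unfolding eq1 by (intro add_mono mult_left_mono) auto
      qed
      \<comment> \<open>The coefficient of n Q is 64/3 + 384 + 4480 < 5000; in the logarithmic term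
        68/3 < 24 and 96 < 5000.\<close>
      finally have "?D \<le> 5000 * (real n * Q) + (5000 + 24 * \<alpha>) * (\<sigma>\<^sup>2 * L)"
        using mult_nonneg_nonneg[of "real n" Q] Q0 by linarith
      then have "?D / real n \<le> (5000 * (real n * Q) + (5000 + 24 * \<alpha>) * (\<sigma>\<^sup>2 * L)) / real n"
        by (rule divide_right_mono) simp
      also have "\<dots> = 5000 * Q + (5000 + 24 * \<alpha>) * \<sigma>\<^sup>2 * (L / real n)"
        using n by (simp add: add_divide_distrib)
      finally show ?thesis by (simp add: L_def)
    qed
    with A(1,2) show ?thesis unfolding holds_with_prob_at_least_def by blast
  qed
  then show "holds_with_prob_at_least (gaussian_noise n \<sigma>) (1 - 2 * real n powr (- \<alpha>))
      (\<lambda>z. let y = (\<lambda>i. \<theta> i + z i) in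
        (1 / real n) * (eucl_norm n (\<lambda>i. \<theta>hat y i - \<theta> i))\<^sup>2
          \<le> 5000 * \<sigma> powr (4/3) * (total_range n \<theta> + \<sigma>) powr (2/3) * real n powr (- 2/3)
            + (5000 + 24 * \<alpha>) * \<sigma>\<^sup>2 * (ln (real n) / real n))"
    by (simp add: Let_def Q_def V_def mult.assoc)
qed simp

end
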